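(* Let $\mathbb{G}$ be a compact quantum group such that its dual $\widehat{\mathbb{G}}$ has subexponential growth. Then for every finite-dimensional unitary representation $U$ of $\mathbb{G}$ the eigenvalues of $\rho_U$ are symmetric, i.e. the list of eigenvalues of $\rho_U$ (with multiplicities, in descending order) coincides with the list of eigenvalues of $\rho_U^{-1}$ (with multiplicities, in descending order).
   Context: A compact quantum group $\mathbb{G}$ is given by a unital C*-algebra $C(\mathbb{G})$ with a unital coassociative $*$-homomorphism $\Delta:C(\mathbb{G})\to C(\mathbb{G})\otimes C(\mathbb{G})$ satisfying the cancellation (density) conditions. A finite-dimensional representation on a nonzero finite-dimensional Hilbert space $H$ is an invertible $U\in B(H)\otimes C(\mathbb{G})$ with $(\iota\otimes\Delta)(U)=U_{12}U_{13}$; it is unitary if $U$ is unitary. $\mathrm{Mor}(U,V)$ is the space of operators $T:H_U\to H_V$ with $(T\otimes 1)U=V(T\otimes 1)$, and $\mathrm{End}(U)=\mathrm{Mor}(U,U)$. The tensor product of $U$ and $V$ is $U_{13}V_{23}$ on $H_U\otimes H_V$; the $0$-th tensor power is the trivial one-dimensional representation. The contragredient of $U$ is the representation $U^{c}=(j\otimes\iota)(U^{-1})$ on the conjugate Hilbert space $\overline{H}$, where $j(T)\overline{\xi}=\overline{T^*\xi}$; $U^{cc}=(U^{c})^{c}$ is regarded as a representation on $H$ via $\overline{\overline{H}}=H$. For a finite-dimensional unitary representation $U$, $\rho_U$ denotes the unique positive invertible operator in $\mathrm{Mor}(U,U^{cc})$ such that $\mathrm{Tr}(T\rho_U)=\mathrm{Tr}(T\rho_U^{-1})$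 for all $T\in\mathrm{End}(U)$. Subexponential growth: for a finite-dimensional unitary representation $U$ and $n\in\mathbb{N}$ let $b(U,n)=\sum_{\alpha}(\dim\alpha)^2$, where $\alpha$ ranges over all pairwise nonequivalent (one per equivalence class) irreducible subrepresentations of the direct sum over $k=0,\dots,n$ of the $k$-th tensor powers of $U$. The dual $\widehat{\mathbb{G}}$ has subexponential growth if $\lim_{n\to\infty} b(U,n)^{1/n}=1$ for every finite-dimensional unitary representation $U$ of $\mathbb{G}$. *)

theory Defs
  imports
    "HOL-Analysis.Elementary_Topology"
    "Jordan_Normal_Form.Schur_Decomposition"
begin

section \<open>Unital C*-algebras\<close>

text \<open>The superclass \<^class>\<open>real_normed_algebra_1\<close> provides \<open>norm 1 = 1\<close>, so the zero algebra is
  excluded.\<close>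

class unital_cstar_algebra = real_normed_algebra_1 + banach +
  fixes scaleC :: "complex \<Rightarrow> 'a \<Rightarrow> 'a" (infixr \<open>*\<^sub>C\<close> 75)
    and star :: "'a \<Rightarrow> 'a"
  assumes scaleC_add_right: "c *\<^sub>C (x + y) = c *\<^sub>C x + c *\<^sub>C y"
    and scaleC_add_left: "(c + d) *\<^sub>C x = c *\<^sub>C x + d *\<^sub>C x"
    and scaleC_scaleC: "c *\<^sub>C d *\<^sub>C x = (c * d) *\<^sub>C x"
    and scaleR_scaleC: "r *\<^sub>R x = complex_of_real r *\<^sub>C x"
    and mult_scaleC_left: "(c *\<^sub>C x) * y = c *\<^sub>C (x * y)"
    and mult_scaleC_right: "x * (c *\<^sub>C y) = c *\<^sub>C (x * y)"
    and norm_scaleC: "norm (c *\<^sub>C x) = cmod c * norm x"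
    and star_star: "star (star x) = x"
    and star_add: "star (x + y) = star x + star y"
    and star_scaleC: "star (c *\<^sub>C x) = cnj c *\<^sub>C star x"
    and star_mult: "star (x * y) = star y * star x"
    and norm_star_mult: "norm (star x * x) = (norm x)\<^sup>2"

global_interpretation cspace: vector_space "scaleC :: complex \<Rightarrow> 'a::unital_cstar_algebra \<Rightarrow> 'a"
proof
  fix x :: 'a
  show "1 *\<^sub>C x = x"
    using scaleR_scaleC[of 1 x] by simp
qed (simp_all add: scaleC_add_right scaleC_add_left scaleC_scaleC)

definition star_hom :: "('a::unital_cstar_algebra \<Rightarrow> 'b::unital_cstar_algebra) \<Rightarrow> bool" where
  "star_hom f \<longleftrightarrow>
     (\<forall>x y. f (x + y) = f x + f y) \<and> (\<forall>c x. f (c *\<^sub>C x) = c *\<^sub>C f x) \<and>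
     (\<forall>x y. f (x * y) = f x * f y) \<and> (\<forall>x. f (star x) = star (f x)) \<and> f 1 = 1"

section \<open>Minimal tensor products\<close>

definition cstar_norm_on :: "'a::unital_cstar_algebra set \<Rightarrow> ('a \<Rightarrow> real) \<Rightarrow> bool" where
  "cstar_norm_on S p \<longleftrightarrow>
     (\<forall>x\<in>S. 0 \<le> p x \<and> (p x = 0 \<longleftrightarrow> x = 0)) \<and>
     (\<forall>x\<in>S. \<forall>y\<in>S. p (x + y) \<le> p x + p y \<and> p (x * y) \<le> p x * p y) \<and>
     (\<forall>c. \<forall>x\<in>S. p (c *\<^sub>C x) = cmod c * p x) \<and>
     (\<forall>x\<in>S. p (star x * x) = (p x)\<^sup>2)"

text \<open>\<open>tens\<close> exhibits the type \<open>'c\<close> as the minimal C*-tensor product of \<open>'a\<close> and \<open>'b\<close>, that is, as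
  the completion of the algebraic tensor product (embedded as the span of elementary tensors, by
  \<open>tens_free\<close>) in its least C*-norm.  This determines \<open>'c\<close> up to isomorphism.\<close>

locale min_tensor_product =
  fixes tens :: "'a::unital_cstar_algebra \<Rightarrow> 'b::unital_cstar_algebra \<Rightarrow> 'c::unital_cstar_algebra"
  assumes tens_add_left: "tens (a + a') b = tens a b + tens a' b"
    and tens_add_right: "tens a (b + b') = tens a b + tens a b'"
    and tens_scaleC_left: "tens (c *\<^sub>C a) b = c *\<^sub>C tens a b"
    and tens_scaleC_right: "tens a (c *\<^sub>C b) = c *\<^sub>C tens a b"
    and tens_mult: "tens a b * tens a' b' = tens (a * a') (b * b')"
    and tens_star: "star (tens a b) = tens (star a) (star b)"
    and tens_one: "tens 1 1 = 1"
    and tens_free: "\<lbrakk>finite B; cspace.independent B; (\<Sum>b\<in>B. tens (f b) b) = 0\<rbrakk>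
                      \<Longrightarrow> \<forall>b\<in>B. f b = 0"
    and tens_dense: "closure (cspace.span {tens a b |a b. True}) = UNIV"
    and tens_min: "\<lbrakk>cstar_norm_on (cspace.span {tens a b |a b. True}) p;
                      x \<in> cspace.span {tens a b |a b. True}\<rbrakk> \<Longrightarrow> norm x \<le> p x"

section \<open>Compact quantum groups\<close>

text \<open>Here \<open>'a\<close> is $C(G)$, \<open>'b\<close> is $C(G) \otimes C(G)$ and \<open>'c\<close> is $C(G) \otimes C(G) \otimes C(G)$,
  the latter being the tensor product both of \<open>'b\<close> and \<open>'a\<close> (\<open>tens_l\<close>) and of \<open>'a\<close> and \<open>'b\<close>
  (\<open>tens_r\<close>).  The homomorphisms \<open>F\<close> and \<open>G\<close> in \<open>coassoc\<close> are $\Delta \otimes \iota$ and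
  $\iota \otimes \Delta$; by density they are determined by their values on elementary tensors.\<close>

locale compact_quantum_group =
  aa: min_tensor_product tens + ba: min_tensor_product tens_l + ab: min_tensor_product tens_r
  for tens :: "'a::unital_cstar_algebra \<Rightarrow> 'a \<Rightarrow> 'b::unital_cstar_algebra"
    and tens_l :: "'b \<Rightarrow> 'a \<Rightarrow> 'c::unital_cstar_algebra"
    and tens_r :: "'a \<Rightarrow> 'b \<Rightarrow> 'c" +
  fixes \<Delta> :: "'a \<Rightarrow> 'b"
  assumes tens_assoc: "tens_l (tens x y) z = tens_r x (tens y z)"
    and comult_hom: "star_hom \<Delta>"
    and coassoc: "\<exists>F G. star_hom F \<and> (\<forall>x y. F (tens x y) = tens_l (\<Delta> x) y) \<and>
                        star_hom G \<and> (\<forall>x y. G (tens x y) = tens_r x (\<Delta> y)) \<and>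
                        (\<forall>x. F (\<Delta> x) = G (\<Delta> x))"
    and cancel_left: "closure (cspace.span {tens x 1 * \<Delta> y |x y. True}) = UNIV"
    and cancel_right: "closure (cspace.span {tens 1 x * \<Delta> y |x y. True}) = UNIV"

section \<open>Finite-dimensional representations\<close>

text \<open>A finite-dimensional Hilbert space is given by an orthonormal basis, so that $B(H) \otimes C(G)$
  is the algebra of \<open>n \<times> n\<close> matrices over $C(G)$ with \<open>n = dim H\<close>.\<close>

definition star_mat :: "'a::unital_cstar_algebra mat \<Rightarrow> 'a mat" where
  "star_mat U = map_mat star (transpose_mat U)"

text \<open>The element $T \otimes 1$ for a scalar matrix \<open>T\<close>:\<close>

definition amp :: "complex mat \<Rightarrow> 'a::unital_cstar_algebra mat" where
  "amp T = map_mat (\<lambda>c. c *\<^sub>C 1) T"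

text \<open>The products of matrices over the tensor square below are $U_{12} U_{13}$.\<close>

definition representation ::
  "('a::unital_cstar_algebra \<Rightarrow> 'a \<Rightarrow> 'b::unital_cstar_algebra) \<Rightarrow> ('a \<Rightarrow> 'b) \<Rightarrow> 'a mat \<Rightarrow> bool" where
  "representation tens \<Delta> U \<longleftrightarrow>
     0 < dim_row U \<and> invertible_mat U \<and>
     map_mat \<Delta> U = map_mat (\<lambda>a. tens a 1) U * map_mat (\<lambda>a. tens 1 a) U"

definition unitary_representation ::
  "('a::unital_cstar_algebra \<Rightarrow> 'a \<Rightarrow> 'b::unital_cstar_algebra) \<Rightarrow> ('a \<Rightarrow> 'b) \<Rightarrow> 'a mat \<Rightarrow> bool" where
  "unitary_representation tens \<Delta> U \<longleftrightarrow>
     representation tens \<Delta> U \<and> inverts_mat (star_mat U) U \<and> inverts_mat U (star_mat U)"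

definition Mor :: "'a::unital_cstar_algebra mat \<Rightarrow> 'a mat \<Rightarrow> complex mat set" where
  "Mor U V = {T \<in> carrier_mat (dim_row V) (dim_row U). amp T * U = V * amp T}"

abbreviation End :: "'a::unital_cstar_algebra mat \<Rightarrow> complex mat set" where
  "End U \<equiv> Mor U U"

definition equivalent_rep :: "'a::unital_cstar_algebra mat \<Rightarrow> 'a mat \<Rightarrow> bool" where
  "equivalent_rep U V \<longleftrightarrow> (\<exists>T\<in>Mor U V. invertible_mat T)"

text \<open>The matrix of $U_{13} V_{23}$ in the product basis, the pair \<open>(i, k)\<close> being encoded as
  \<open>i * dim V + k\<close>; its entries are $u_{ij} v_{kl}$.\<close>

definition tensor_rep :: "'a::unital_cstar_algebra mat \<Rightarrow> 'a mat \<Rightarrow> 'a mat" where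
  "tensor_rep U V =
     mat (dim_row U * dim_row V) (dim_col U * dim_col V)
       (\<lambda>(r, s). U $$ (r div dim_row V, s div dim_col V) * V $$ (r mod dim_row V, s mod dim_col V))"

fun tensor_power :: "'a::unital_cstar_algebra mat \<Rightarrow> nat \<Rightarrow> 'a mat" where
  "tensor_power U 0 = 1\<^sub>m 1"
| "tensor_power U (Suc k) = tensor_rep (tensor_power U k) U"

section \<open>The contragredient and the operator rho\<close>

text \<open>\<open>V\<close> is the representation $U^c = (j \otimes \iota)(U^{-1})$.  If \<open>T\<close> has matrix $(t_{kl})$ in an
  orthonormal basis $(e_k)$ of $H$, then $j(T)$ has the transposed matrix in the basis
  $(\overline{e_k})$ of the conjugate space; entries in $C(G)$ are unchanged, so $U^c$ is the
  transpose of $U^{-1}$.  The basis of the double conjugate space obtained in this way is $(e_k)$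
  again, which is the identification of that space with $H$.\<close>

definition is_contragredient ::
  "('a::unital_cstar_algebra \<Rightarrow> 'a \<Rightarrow> 'b::unital_cstar_algebra) \<Rightarrow> ('a \<Rightarrow> 'b) \<Rightarrow>
   'a mat \<Rightarrow> 'a mat \<Rightarrow> bool" where
  "is_contragredient tens \<Delta> U V \<longleftrightarrow>
     representation tens \<Delta> U \<and> representation tens \<Delta> V \<and>
     inverts_mat U (transpose_mat V) \<and> inverts_mat (transpose_mat V) U"

definition mat_trace :: "'a::comm_monoid_add mat \<Rightarrow> 'a" where
  "mat_trace A = (\<Sum>i<dim_row A. A $$ (i, i))"

definition mat_inv :: "'a::semiring_1 mat \<Rightarrow> 'a mat" where
  "mat_inv A = (THE B. inverts_mat A B \<and> inverts_mat B A)"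

text \<open>The order on \<^typ>\<open>complex\<close> is the one for which \<open>0 \<le> z\<close> says that \<open>z\<close> is real and
  nonnegative.\<close>

definition positive_invertible :: "complex mat \<Rightarrow> bool" where
  "positive_invertible A \<longleftrightarrow>
     invertible_mat A \<and> (\<forall>v\<in>carrier_vec (dim_row A). 0 \<le> (A *\<^sub>v v) \<bullet>c v)"

text \<open>The defining property of $\rho_U$; the witness \<open>W\<close> is $U^{cc}$.\<close>

definition is_rho ::
  "('a::unital_cstar_algebra \<Rightarrow> 'a \<Rightarrow> 'b::unital_cstar_algebra) \<Rightarrow> ('a \<Rightarrow> 'b) \<Rightarrow>
   'a mat \<Rightarrow> complex mat \<Rightarrow> bool" where
  "is_rho tens \<Delta> U \<rho> \<longleftrightarrow>
     positive_invertible \<rho> \<and>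
     (\<exists>V W. is_contragredient tens \<Delta> U V \<and> is_contragredient tens \<Delta> V W \<and> \<rho> \<in> Mor U W) \<and>
     (\<forall>T\<in>End U. mat_trace (T * \<rho>) = mat_trace (T * mat_inv \<rho>))"

text \<open>Eigenvalues with algebraic multiplicities in descending order, for matrices with real
  spectrum.\<close>

definition eigenvalue_list :: "complex mat \<Rightarrow> real list" where
  "eigenvalue_list A = rev (sorted_list_of_multiset (image_mset Re (proots (char_poly A))))"

section \<open>Subexponential growth of the dual\<close>

definition irreducible_rep :: "'a::unital_cstar_algebra mat \<Rightarrow> bool" where
  "irreducible_rep U \<longleftrightarrow> End U = {c \<cdot>\<^sub>m 1\<^sub>m (dim_row U) |c. True}"

text \<open>The subrepresentations of a unitary representation \<open>W\<close> are its restrictions to the ranges of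
  isometric intertwiners; all unitary copies of them are included here.\<close>

definition irreducible_subreps ::
  "('a::unital_cstar_algebra \<Rightarrow> 'a \<Rightarrow> 'b::unital_cstar_algebra) \<Rightarrow> ('a \<Rightarrow> 'b) \<Rightarrow>
   'a mat \<Rightarrow> 'a mat set" where
  "irreducible_subreps tens \<Delta> W =
     {\<alpha>. unitary_representation tens \<Delta> \<alpha> \<and> irreducible_rep \<alpha> \<and>
         (\<exists>T\<in>Mor \<alpha> W. inverts_mat (mat_adjoint T) T)}"

definition irreducible_classes ::
  "('a::unital_cstar_algebra \<Rightarrow> 'a \<Rightarrow> 'b::unital_cstar_algebra) \<Rightarrow> ('a \<Rightarrow> 'b) \<Rightarrow>
   'a mat \<Rightarrow> 'a mat set set" where
  "irreducible_classes tens \<Delta> W =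
     irreducible_subreps tens \<Delta> W //
       {(\<alpha>, \<beta>). \<alpha> \<in> irreducible_subreps tens \<Delta> W \<and> \<beta> \<in> irreducible_subreps tens \<Delta> W \<and>
                equivalent_rep \<alpha> \<beta>}"

definition growth ::
  "('a::unital_cstar_algebra \<Rightarrow> 'a \<Rightarrow> 'b::unital_cstar_algebra) \<Rightarrow> ('a \<Rightarrow> 'b) \<Rightarrow>
   'a mat \<Rightarrow> nat \<Rightarrow> nat" where
  "growth tens \<Delta> U n =
     (\<Sum>C\<in>irreducible_classes tens \<Delta> (diag_block_mat (map (tensor_power U) [0..<Suc n])).
        (dim_row (SOME \<alpha>. \<alpha> \<in> C))\<^sup>2)"

definition dual_subexponential_growth ::
  "('a::unital_cstar_algebra \<Rightarrow> 'a \<Rightarrow> 'b::unital_cstar_algebra) \<Rightarrow> ('a \<Rightarrow> 'b) \<Rightarrow> bool" where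
  "dual_subexponential_growth tens \<Delta> \<longleftrightarrow>
     (\<forall>U. unitary_representation tens \<Delta> U \<longrightarrow>
        (\<lambda>n. root n (real (growth tens \<Delta> U n))) \<longlonglongrightarrow> 1)"

end

theory Submission
  imports Defs "Jordan_Normal_Form.Spectral_Radius" "HOL-Analysis.Convex"
begin

text \<open>
  The idea is that the quantum dimensions \<open>Tr \<rho>\<^sub>\<alpha> = Tr (1/\<rho>\<^sub>\<alpha>)\<close> of an irreducible \<open>\<alpha>\<close> control its largest and its
  smallest eigenvalue up to the factor \<open>dim \<alpha>\<close>: the largest eigenvalue is at most \<open>Tr \<rho>\<^sub>\<alpha>\<close>, and \<open>Tr (1/\<rho>\<^sub>\<alpha>)\<close>
  is at most \<open>dim \<alpha>\<close> times the largest eigenvalue of \<open>(1/\<rho>\<^sub>\<alpha>)\<close>.  Hence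
  \<open>Tr \<rho>\<^sub>\<alpha>\<^sup>k \<le> (dim \<alpha>)^(k+1) Tr (1/\<rho>\<^sub>\<alpha>)\<^sup>k\<close> for every \<open>k\<close>, and the same with \<open>\<rho>\<^sub>\<alpha>\<close> and its inverse exchanged.
  The operator of the \<open>n\<close>-th tensor power of \<open>U\<close> is the \<open>n\<close>-th tensor power of \<open>\<rho>\<close>, and it splits
  along a decomposition of that tensor power into irreducibles, all of which have squared dimension at
  most \<open>b(U, n)\<close>.  Adding up gives
  \<open>(Tr \<rho>\<^sup>k)\<^sup>n \<le> b(U, n)^(k+1) (Tr (1/\<rho>)\<^sup>k)\<^sup>n\<close>; taking \<open>n\<close>-th roots and letting \<open>n\<close> grow, subexponential growth
  makes the factor disappear, so \<open>Tr \<rho>\<^sup>k = Tr (1/\<rho>)\<^sup>k\<close> for all \<open>k\<close>.  The power sums of a list of reals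
  determine the list up to order.

  An orthonormal basis of eigenvectors of \<open>\<rho>\<close> is used throughout, so that \<open>\<rho>\<close> becomes a family of
  positive weights \<open>r i\<close> on basis vectors, and the one of the tensor power the products of these weights.
  Three properties of the weights are enough, collected in \<open>spherical_weights\<close>: two orthogonality
  relations, which say that \<open>\<rho>\<close> intertwines \<open>U\<close> with its double contragredient, and the equality of the two
  traces on \<open>End(U)\<close>.  Together they are stable under tensor products (\<open>spherical_weights_tensor\<close>): the
  orthogonality relations make the two partial traces of an intertwiner of \<open>U \<otimes> V\<close> intertwiners of \<open>U\<close> and of \<open>V\<close>,
  and the trace condition is applied to one factor after the other.  They also imply that the weights
  commute with all intertwiners (\<open>End_commutes_with_weights\<close>), so that a projection in \<open>End\<close> of the
  tensor power inherits the estimate (\<open>weighted_trace_of_projection_bound\<close>).  The passage from irreducible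
  to arbitrary subrepresentations is an induction on the dimension (\<open>weighted_trace_bound\<close>), splitting a
  reducible representation along an eigenspace of a Hermitian intertwiner (\<open>reducible_splits\<close>).
\<close>

section \<open>Unitary diagonalization of Hermitian matrices\<close>

lemma mat_adjoint_dim [simp]:
  "dim_row (mat_adjoint A) = dim_col A" "dim_col (mat_adjoint A) = dim_row A"
  by (simp_all add: mat_adjoint_def)

lemma mat_adjoint_closed [simp]: "A \<in> carrier_mat n m \<Longrightarrow> mat_adjoint A \<in> carrier_mat m n"
  by (rule carrier_matI) auto

lemma mat_adjoint_index [simp]:
  fixes A :: "complex mat"
  shows "i < dim_col A \<Longrightarrow> j < dim_row A \<Longrightarrow> mat_adjoint A $$ (i, j) = cnj (A $$ (j, i))"
  by (simp add: mat_adjoint_def mat_of_rows_def)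

lemma mat_adjoint_mat_adjoint [simp]: "mat_adjoint (mat_adjoint (A :: complex mat)) = A"
  by (rule eq_matI) auto

text \<open>Takes the place of the scalar product of a row and a column, which hides the entries.\<close>

lemma mat_mult_index:
  assumes "i < dim_row A" "j < dim_col B" "dim_col A = dim_row B"
  shows "(A * B) $$ (i, j) = (\<Sum>k<dim_col A. A $$ (i, k) * B $$ (k, j))"
  using assms by (simp add: scalar_prod_def lessThan_atLeast0)

declare index_mult_mat(1) [simp del]

lemma mat_adjoint_mult:
  fixes A :: "complex mat"
  assumes "A \<in> carrier_mat n m" "B \<in> carrier_mat m p"
  shows "mat_adjoint (A * B) = mat_adjoint B * mat_adjoint A"
proof (rule eq_matI)
  fix i j assume ij: "i < dim_row (mat_adjoint B * mat_adjoint A)" "j < dim_col (mat_adjoint B * mat_adjoint A)"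
  then have "i < p" "j < n" using assms by auto
  then show "mat_adjoint (A * B) $$ (i, j) = (mat_adjoint B * mat_adjoint A) $$ (i, j)"
    using assms by (simp add: mat_mult_index mult.commute)
qed (use assms in auto)

lemma mat_adjoint_one [simp]: "mat_adjoint (1\<^sub>m n :: complex mat) = 1\<^sub>m n"
  by (rule eq_matI) auto

text \<open>Gram-Schmidt applied to a basis that starts with \<open>v\<close> keeps the direction of \<open>v\<close>; normalizing the result gives the unitary.\<close>

lemma orthonormal_columns_extending:
  fixes v :: "complex vec"
  assumes v: "v \<in> carrier_vec n" "v \<noteq> 0\<^sub>v n"
  shows "\<exists>W c. W \<in> carrier_mat n n \<and> mat_adjoint W * W = 1\<^sub>m n \<and> (\<forall>i<n. W $$ (i, 0) = c * v $ i)"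
proof -
  interpret cof_vec_space n "TYPE(complex)" .
  define ws where "ws = gram_schmidt n (basis_completion v)"
  note b = basis_completion[OF v]
  have ws: "set ws \<subseteq> carrier_vec n" "corthogonal ws" "length ws = n"
    using gram_schmidt_result[OF b(2) b(4) b(5) ws_def] b(6) by auto
  have n0: "n > 0" using v by (cases n) auto
  obtain vs where "basis_completion v = v # vs"
    using b(6,7) n0 by (cases "basis_completion v") auto
  then have hd: "hd ws = v" unfolding ws_def using gram_schmidt_hd[OF v(1)] by simp
  then have ws0: "ws ! 0 = v" using ws(3) n0 by (metis hd_conv_nth length_greater_0_conv)
  define s where "s j = sqrt (Re (ws ! j \<bullet>c ws ! j))" for j
  have wsc: "ws ! j \<in> carrier_vec n" if "j < n" for j using ws that by auto
  have s: "complex_of_real (s j * s j) = ws ! j \<bullet>c ws ! j" "s j \<noteq> 0" if "j < n" for j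
  proof -
    have "ws ! j \<bullet>c ws ! j \<noteq> 0" using corthogonalD[OF ws(2), of j j] that ws(3) by auto
    moreover have "ws ! j \<bullet>c ws ! j \<ge> 0" by (rule conjugate_square_ge_0_vec)
    ultimately have *: "Re (ws ! j \<bullet>c ws ! j) > 0" "Im (ws ! j \<bullet>c ws ! j) = 0"
      by (auto simp: less_eq_complex_def complex_eq_iff)
    show "s j \<noteq> 0" "complex_of_real (s j * s j) = ws ! j \<bullet>c ws ! j"
      using * by (auto simp: s_def complex_eq_iff)
  qed
  define W where "W = mat n n (\<lambda>(i, j). ws ! j $ i / complex_of_real (s j))"
  have W: "W \<in> carrier_mat n n" by (simp add: W_def)
  have "mat_adjoint W * W = 1\<^sub>m n"
  proof (rule eq_matI)
    fix i j assume "i < dim_row (1\<^sub>m n :: complex mat)" "j < dim_col (1\<^sub>m n :: complex mat)"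
    then have i: "i < n" and j: "j < n" by auto
    have "(mat_adjoint W * W) $$ (i, j) = (\<Sum>k<n. ws ! j $ k * cnj (ws ! i $ k)) / complex_of_real (s i * s j)"
      using i j W by (simp add: mat_mult_index sum_divide_distrib W_def mult.commute)
    also have "(\<Sum>k<n. ws ! j $ k * cnj (ws ! i $ k)) = ws ! j \<bullet>c ws ! i"
      using wsc[OF i] wsc[OF j] by (simp add: scalar_prod_def lessThan_atLeast0)
    also have "\<dots> / complex_of_real (s i * s j) = (if i = j then 1 else 0)"
      using s[OF i] corthogonalD[OF ws(2), of j i] i j ws(3) by auto
    finally show "(mat_adjoint W * W) $$ (i, j) = 1\<^sub>m n $$ (i, j)" using i j by simp
  qed (use W in auto)
  moreover have "\<forall>i<n. W $$ (i, 0) = inverse (complex_of_real (s 0)) * v $ i"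
    using n0 by (auto simp: W_def ws0 divide_inverse mult.commute)
  ultimately show ?thesis using W by (intro exI[of _ W] exI[of _ "inverse (complex_of_real (s 0))"] conjI)
qed

definition diag_of :: "nat \<Rightarrow> (nat \<Rightarrow> complex) \<Rightarrow> complex mat" where
  "diag_of n d = mat n n (\<lambda>(i, j). if i = j then d i else 0)"

lemma diag_of_carrier [simp]: "diag_of n d \<in> carrier_mat n n"
  by (simp add: diag_of_def)

lemma diag_of_dim [simp]: "dim_row (diag_of n d) = n" "dim_col (diag_of n d) = n"
  by (simp_all add: diag_of_def)

text \<open>Deflation: a unitary whose first column is an eigenvector brings \<open>A\<close> into block form, because for a Hermitian
  matrix the first row vanishes off the diagonal together with the first column.\<close>

theorem hermitian_unitary_diagonalization:
  fixes A :: "complex mat"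
  assumes "A \<in> carrier_mat n n" "mat_adjoint A = A"
  shows "\<exists>V d. V \<in> carrier_mat n n \<and> mat_adjoint V * V = 1\<^sub>m n \<and> V * mat_adjoint V = 1\<^sub>m n \<and>
           mat_adjoint V * A * V = diag_of n (\<lambda>i. complex_of_real (d i))"
  using assms
proof (induction n arbitrary: A)
  case 0
  then show ?case by (intro exI[of _ "1\<^sub>m 0"] exI[of _ "\<lambda>_. 0"] conjI eq_matI) auto
next
  case (Suc n A)
  let ?m = "Suc n"
  obtain e v where v: "v \<in> carrier_vec ?m" "v \<noteq> 0\<^sub>v ?m" and ev: "A *\<^sub>v v = e \<cdot>\<^sub>v v"
    using spectrum_non_empty[OF Suc.prems(1)] Suc.prems(1)
    by (auto simp: spectrum_def eigenvalue_def eigenvector_def)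
  obtain W c where W: "W \<in> carrier_mat ?m ?m" and WW: "mat_adjoint W * W = 1\<^sub>m ?m"
    and W0: "\<And>i. i < ?m \<Longrightarrow> W $$ (i, 0) = c * v $ i"
    using orthonormal_columns_extending[OF v] by blast
  have W': "mat_adjoint W \<in> carrier_mat ?m ?m" using W by simp
  have WW': "W * mat_adjoint W = 1\<^sub>m ?m"
    using mat_mult_left_right_inverse[OF W' W WW] .
  define B where "B = mat_adjoint W * A * W"
  have B: "B \<in> carrier_mat ?m ?m" using W Suc.prems unfolding B_def by auto
  have AW: "A * W \<in> carrier_mat ?m ?m" using W Suc.prems by auto
  have Bherm: "mat_adjoint B = B"
    unfolding B_def
    using W W' Suc.prems by (simp add: mat_adjoint_mult[of _ ?m ?m _ ?m] assoc_mult_mat[of _ ?m ?m _ ?m _ ?m])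
  have B': "cnj (B $$ (j, i)) = B $$ (i, j)" if "i < ?m" "j < ?m" for i j
    using that B arg_cong[OF Bherm, of "\<lambda>M. M $$ (i, j)"] by simp
  have AW0: "(A * W) $$ (i, 0) = e * W $$ (i, 0)" if i: "i < ?m" for i
  proof -
    have "(A * W) $$ (i, 0) = c * (\<Sum>k<?m. A $$ (i, k) * v $ k)"
      using i Suc.prems W by (simp add: mat_mult_index W0 sum_distrib_left ac_simps del: sum.lessThan_Suc)
    also have "(\<Sum>k<?m. A $$ (i, k) * v $ k) = (A *\<^sub>v v) $ i"
      using i Suc.prems v by (simp add: scalar_prod_def lessThan_atLeast0 del: sum.lessThan_Suc sum.atLeast0_lessThan_Suc)
    finally show ?thesis using ev i v by (simp add: W0)
  qed
  have B0: "B $$ (i, 0) = (if i = 0 then e else 0)" if i: "i < ?m" for i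
  proof -
    have "B $$ (i, 0) = (mat_adjoint W * (A * W)) $$ (i, 0)"
      unfolding B_def using W W' Suc.prems by (simp add: assoc_mult_mat[of _ ?m ?m _ ?m _ ?m])
    also have "\<dots> = (\<Sum>k<?m. mat_adjoint W $$ (i, k) * (e * W $$ (k, 0)))"
      using i W' W Suc.prems by (simp add: mat_mult_index[of i "mat_adjoint W"] AW0 del: sum.lessThan_Suc)
    also have "\<dots> = e * (mat_adjoint W * W) $$ (i, 0)"
      using i W W' by (simp add: mat_mult_index sum_distrib_left ac_simps del: sum.lessThan_Suc)
    finally show ?thesis using i WW by simp
  qed
  have e_real: "complex_of_real (Re e) = e"
    using B'[of 0 0] B0[of 0] by (simp add: complex_eq_iff)
  have B0': "B $$ (0, i) = (if i = 0 then e else 0)" if "i < ?m" for i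
    using B'[of 0 i] B0[OF that] that e_real
    by (metis (full_types) complex_cnj_cancel_iff complex_cnj_complex_of_real complex_cnj_zero zero_less_Suc)
  define C where "C = mat n n (\<lambda>(i, j). B $$ (Suc i, Suc j))"
  have C: "C \<in> carrier_mat n n" by (simp add: C_def)
  have B_eq: "B = four_block_mat (e \<cdot>\<^sub>m 1\<^sub>m 1) (0\<^sub>m 1 n) (0\<^sub>m n 1) C"
    by (rule eq_matI) (use B in \<open>auto simp: C_def B0 B0'\<close>)
  have "mat_adjoint C = C"
    by (rule eq_matI) (auto simp: C_def B')
  from Suc.IH[OF C this] obtain V d where V: "V \<in> carrier_mat n n" "mat_adjoint V * V = 1\<^sub>m n"
    "V * mat_adjoint V = 1\<^sub>m n" and VC: "mat_adjoint V * C * V = diag_of n (\<lambda>i. complex_of_real (d i))" by blast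
  define V' where "V' = four_block_mat (1\<^sub>m 1) (0\<^sub>m 1 n) (0\<^sub>m n 1) V"
  have V': "V' \<in> carrier_mat ?m ?m" using V unfolding V'_def by auto
  have aV': "mat_adjoint V' = four_block_mat (1\<^sub>m 1) (0\<^sub>m 1 n) (0\<^sub>m n 1) (mat_adjoint V)"
    by (rule eq_matI) (use V in \<open>auto simp: V'_def\<close>)
  have aV: "mat_adjoint V \<in> carrier_mat n n" using V by simp
  have one: "1\<^sub>m ?m = four_block_mat (1\<^sub>m 1) (0\<^sub>m 1 n) (0\<^sub>m n 1) (1\<^sub>m n :: complex mat)"
    by (rule eq_matI) auto
  have VV: "mat_adjoint V' * V' = 1\<^sub>m ?m" "V' * mat_adjoint V' = 1\<^sub>m ?m"
    unfolding aV' unfolding V'_def one using V aV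
    by (simp_all add: mult_four_block_mat[of _ 1 1 _ n _ n _ _ 1 _ n])
  have V'B: "mat_adjoint V' * B * V' = diag_of ?m (\<lambda>i. complex_of_real (case_nat (Re e) d i))"
  proof -
    have "mat_adjoint V' * B = four_block_mat (e \<cdot>\<^sub>m 1\<^sub>m 1) (0\<^sub>m 1 n) (0\<^sub>m n 1) (mat_adjoint V * C)"
      unfolding aV' B_eq using V aV C mult_carrier_mat[OF aV C]
      by (simp add: mult_four_block_mat[of _ 1 1 _ n _ n _ _ 1 _ n])
    then have "mat_adjoint V' * B * V' = four_block_mat (e \<cdot>\<^sub>m 1\<^sub>m 1) (0\<^sub>m 1 n) (0\<^sub>m n 1) (mat_adjoint V * C * V)"
      unfolding V'_def using V aV C mult_carrier_mat[OF aV C] mult_carrier_mat[OF mult_carrier_mat[OF aV C] V(1)]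
      by (simp add: mult_four_block_mat[of _ 1 1 _ n _ n _ _ 1 _ n])
    also have "\<dots> = diag_of ?m (\<lambda>i. complex_of_real (case_nat (Re e) d i))"
      unfolding VC
      by (rule eq_matI) (auto simp: diag_of_def e_real split: nat.splits)
    finally show ?thesis .
  qed
  have aWV: "mat_adjoint (W * V') = mat_adjoint V' * mat_adjoint W"
    using W V' by (rule mat_adjoint_mult)
  have acV': "mat_adjoint V' \<in> carrier_mat ?m ?m" using V' by simp
  note as = assoc_mult_mat[of _ ?m ?m _ ?m _ ?m]
  have "mat_adjoint (W * V') * (W * V') = mat_adjoint V' * ((mat_adjoint W * W) * V')"
    unfolding aWV using W W' V' acV' by (simp add: as)
  then have 1: "mat_adjoint (W * V') * (W * V') = 1\<^sub>m ?m" using WW VV V' by simp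
  have "W * V' * mat_adjoint (W * V') = W * ((V' * mat_adjoint V') * mat_adjoint W)"
    unfolding aWV using W W' V' acV' mult_carrier_mat[OF acV' W'] by (simp add: as)
  then have 2: "W * V' * mat_adjoint (W * V') = 1\<^sub>m ?m" using WW' VV W' using left_mult_one_mat[OF W'] by simp
  have "mat_adjoint (W * V') * A * (W * V') = mat_adjoint V' * B * V'"
    unfolding aWV B_def using W W' V' acV' Suc.prems(1) mult_carrier_mat[OF W' Suc.prems(1)]
      mult_carrier_mat[OF W V'] mult_carrier_mat[OF W' AW] AW by (simp add: as)
  then have 3: "mat_adjoint (W * V') * A * (W * V') = diag_of ?m (\<lambda>i. complex_of_real (case_nat (Re e) d i))"
    using V'B by (rule trans)
  show ?case
    by (intro exI[of _ "W * V'"] exI[of _ "case_nat (Re e) d"] conjI mult_carrier_mat[OF W V'] 1 2 3)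
qed

section \<open>Matrices over a C*-algebra and compressions to invariant subspaces\<close>

text \<open>Stated with dimensions instead of carriers, so that the simplifier can discharge the side conditions.\<close>

lemma mat_assoc:
  assumes "dim_col A = dim_row B" "dim_col B = dim_row (C :: 'a::semiring_0 mat)"
  shows "A * B * C = A * (B * C)"
  by (rule assoc_mult_mat[of _ "dim_row A" "dim_row B" _ "dim_row C" _ "dim_col C"])
    (use assms in \<open>auto intro: carrier_matI\<close>)

declare left_mult_one_mat' [simp] right_mult_one_mat' [simp]

lemma star_zero [simp]: "star (0 :: 'a::unital_cstar_algebra) = 0"
  using star_add[of "0 :: 'a" 0] by simp

lemma star_one [simp]: "star (1 :: 'a::unital_cstar_algebra) = 1"
  by (metis mult_1 mult.right_neutral star_mult star_star)

lemma star_sum: "star (sum f I) = (\<Sum>i\<in>I. star (f i :: 'a::unital_cstar_algebra))"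
  by (induction I rule: infinite_finite_induct) (simp_all add: star_add)

lemma star_hom_zero [simp]: "star_hom f \<Longrightarrow> f 0 = 0"
  by (metis star_hom_def add_cancel_right_right)

lemma star_hom_sum: "star_hom f \<Longrightarrow> f (sum g I) = (\<Sum>i\<in>I. f (g i))"
  by (induction I rule: infinite_finite_induct) (simp_all, simp add: star_hom_def)

lemma star_mat_dim [simp]: "dim_row (star_mat A) = dim_col A" "dim_col (star_mat A) = dim_row A"
  by (simp_all add: star_mat_def)

lemma star_mat_closed [simp]: "A \<in> carrier_mat n m \<Longrightarrow> star_mat A \<in> carrier_mat m n"
  by (rule carrier_matI) auto

lemma star_mat_index [simp]: "i < dim_col A \<Longrightarrow> j < dim_row A \<Longrightarrow> star_mat A $$ (i, j) = star (A $$ (j, i))"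
  by (simp add: star_mat_def)

lemma star_mat_mult:
  assumes "dim_col A = dim_row B"
  shows "star_mat (A * B) = star_mat B * star_mat A"
  by (rule eq_matI) (use assms in \<open>simp_all add: mat_mult_index star_sum star_mult\<close>)

lemma amp_dim [simp]: "dim_row (amp T) = dim_row T" "dim_col (amp T) = dim_col T"
  by (simp_all add: amp_def)

lemma amp_closed [simp]: "T \<in> carrier_mat n m \<Longrightarrow> amp T \<in> carrier_mat n m"
  by (rule carrier_matI) auto

lemma amp_index [simp]: "i < dim_row T \<Longrightarrow> j < dim_col T \<Longrightarrow> amp T $$ (i, j) = (T $$ (i, j)) *\<^sub>C 1"
  by (simp add: amp_def)

lemma amp_mult:
  assumes "dim_col S = dim_row T"
  shows "amp (S * T) = (amp S * amp T :: 'a::unital_cstar_algebra mat)"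
  by (rule eq_matI)
    (use assms in \<open>simp_all add: mat_mult_index cspace.scale_sum_left mult_scaleC_left scaleC_scaleC\<close>)

lemma amp_one [simp]: "amp (1\<^sub>m n) = 1\<^sub>m n"
  by (rule eq_matI) auto

lemma star_mat_amp: "star_mat (amp T) = amp (mat_adjoint T)"
  by (rule eq_matI) (simp_all add: star_scaleC)

lemma map_mat_star_hom_mult:
  assumes "star_hom f" "dim_col A = dim_row B"
  shows "map_mat f (A * B) = map_mat f A * map_mat f B"
  by (rule eq_matI)
    (use assms in \<open>simp_all add: mat_mult_index star_hom_sum\<close>, simp add: star_hom_def)

lemma map_mat_star_hom_amp: "star_hom f \<Longrightarrow> map_mat f (amp T) = amp T"
  by (rule eq_matI) (simp_all, simp add: star_hom_def)

context min_tensor_product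
begin

lemma star_hom_tens_left: "star_hom (\<lambda>a. tens a 1)"
  unfolding star_hom_def
  using tens_star[of _ 1] by (simp add: tens_add_left tens_scaleC_left tens_mult tens_one)

lemma star_hom_tens_right: "star_hom (\<lambda>a. tens 1 a)"
  unfolding star_hom_def
  using tens_star[of 1] by (simp add: tens_add_right tens_scaleC_right tens_mult tens_one)

end

lemma EndD:
  assumes "X \<in> End W" "W \<in> carrier_mat n n"
  shows "X \<in> carrier_mat n n" "amp X * W = W * amp X"
  using assms by (auto simp: Mor_def)

lemma EndI:
  assumes "X \<in> carrier_mat n n" "W \<in> carrier_mat n n" "amp X * W = W * amp X"
  shows "X \<in> End W"
  using assms by (auto simp: Mor_def)

lemma unitary_representationD:
  assumes "unitary_representation tens \<Delta> W"
  shows "W \<in> carrier_mat (dim_row W) (dim_row W)" "0 < dim_row W"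
    "star_mat W * W = 1\<^sub>m (dim_row W)" "W * star_mat W = 1\<^sub>m (dim_row W)"
  using assms
  by (auto simp: unitary_representation_def representation_def invertible_mat_def inverts_mat_def square_mat.simps)

lemma unitary_representationI:
  assumes "W \<in> carrier_mat n n" "0 < n" "star_mat W * W = 1\<^sub>m n" "W * star_mat W = 1\<^sub>m n"
    "map_mat \<Delta> W = map_mat (\<lambda>a. tens a 1) W * map_mat (\<lambda>a. tens 1 a) W"
  shows "unitary_representation tens \<Delta> W"
  using assms
  by (auto simp: unitary_representation_def representation_def invertible_mat_def inverts_mat_def square_mat.simps
    intro!: exI[of _ "star_mat W"])

text \<open>For an isometry \<open>T\<close> onto an invariant subspace this is the subrepresentation on that subspace, for a unitary \<open>T\<close> it is a change of orthonormal basis.\<close>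

definition compress :: "complex mat \<Rightarrow> 'a::unital_cstar_algebra mat \<Rightarrow> 'a mat" where
  "compress T W = amp (mat_adjoint T) * W * amp T"

lemma compress_closed:
  "T \<in> carrier_mat n d \<Longrightarrow> W \<in> carrier_mat n n \<Longrightarrow> compress T W \<in> carrier_mat d d"
  by (rule carrier_matI) (auto simp: compress_def)

text \<open>The range projection of \<open>T\<close> commutes with \<open>W\<close>, so both it and its complement are invariant; this gives the relation for \<open>T\<close> and for its adjoint.\<close>

lemma compress_intertwines:
  assumes T: "T \<in> carrier_mat n d" and W: "W \<in> carrier_mat n n"
    and iso: "mat_adjoint T * T = 1\<^sub>m d" and P: "T * mat_adjoint T \<in> End W"
  shows "amp T * compress T W = W * amp T" "compress T W * amp (mat_adjoint T) = amp (mat_adjoint T) * W"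
proof -
  let ?T = "amp T :: 'a mat" and ?S = "amp (mat_adjoint T) :: 'a mat"
  have cT: "?T \<in> carrier_mat n d" "?S \<in> carrier_mat d n" using T by auto
  have ST: "?S * ?T = 1\<^sub>m d" using T iso by (simp flip: amp_mult)
  have TS: "?T * ?S * W = W * (?T * ?S)"
    using EndD[OF P W] T by (simp add: amp_mult)
  note c = T cT W
  have "?T * compress T W = ?T * ?S * W * ?T"
    unfolding compress_def using c
    by (simp add: mat_assoc)
  also have "\<dots> = W * (?T * (?S * ?T))"
    unfolding TS using c
    by (simp add: mat_assoc)
  finally show "?T * compress T W = W * ?T" using c by (simp add: ST)
  have "compress T W * ?S = ?S * (W * (?T * ?S))"
    unfolding compress_def using c
    by (simp add: mat_assoc)
  also have "\<dots> = (?S * ?T) * ?S * W"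
    unfolding TS[symmetric] using c
    by (simp add: mat_assoc)
  finally show "compress T W * ?S = ?S * W" using c by (simp add: ST)
qed

text \<open>The scalar projection \<open>T T*\<close>, inserted between the two legs of the comultiplication or between \<open>W\<close> and its adjoint, can be moved past \<open>W\<close> and absorbed.\<close>

lemma compress_unitary_representation:
  fixes W :: "'a::unital_cstar_algebra mat"
  assumes cqg: "compact_quantum_group tens tens_l tens_r \<Delta>"
    and W: "unitary_representation tens \<Delta> W" and n: "dim_row W = n"
    and T: "T \<in> carrier_mat n d" and d: "0 < d"
    and iso: "mat_adjoint T * T = 1\<^sub>m d" and P: "T * mat_adjoint T \<in> End W"
  shows "unitary_representation tens \<Delta> (compress T W)"
proof -
  interpret compact_quantum_group tens tens_l tens_r \<Delta> by fact
  note U = unitary_representationD[OF W, unfolded n]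
  let ?A = "compress T W"
  have A: "?A \<in> carrier_mat d d" using T U by (intro compress_closed)
  have S: "mat_adjoint T \<in> carrier_mat d n" using T by simp
  note int = compress_intertwines[OF T U(1) iso P]
  have star_A: "star_mat ?A = amp (mat_adjoint T) * (star_mat W * amp T)"
    unfolding compress_def using T U(1) by (simp add: star_mat_mult star_mat_amp)
  have sA: "star_mat ?A \<in> carrier_mat d d" using A by simp
  note cs = T amp_closed[OF T, where 'a='a] amp_closed[OF S, where 'a='a] U(1) star_mat_closed[OF U(1)]
  have ST: "amp (mat_adjoint T) * amp T = (1\<^sub>m d :: 'a mat)" using T iso by (simp flip: amp_mult)
  have "star_mat ?A * ?A = amp (mat_adjoint T) * (star_mat W * (amp T * ?A))"
    unfolding star_A using cs A
    by (simp add: mat_assoc)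
  also have "\<dots> = amp (mat_adjoint T) * ((star_mat W * W) * amp T)"
    unfolding int(1) using cs by (simp add: mat_assoc)
  finally have 1: "star_mat ?A * ?A = 1\<^sub>m d"
    using ST cs U(3) by simp
  have "?A * star_mat ?A = (?A * amp (mat_adjoint T)) * (star_mat W * amp T)"
    unfolding star_A using cs A
    by (simp add: mat_assoc)
  also have "\<dots> = amp (mat_adjoint T) * ((W * star_mat W) * amp T)"
    unfolding int(2) using cs
    by (simp add: mat_assoc)
  finally have 2: "?A * star_mat ?A = 1\<^sub>m d"
    using ST cs U(4) by simp
  let ?l = "map_mat (\<lambda>a. tens a 1)" and ?r = "map_mat (\<lambda>a. tens 1 a)"
  have hom: "map_mat f ?A = compress T (map_mat f W)" if "star_hom f" for f :: "'a \<Rightarrow> 'b"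
    unfolding compress_def using that T U(1) by (simp add: map_mat_star_hom_mult map_mat_star_hom_amp)
  have rep: "map_mat \<Delta> W = ?l W * ?r W"
    using W by (simp add: unitary_representation_def representation_def)
  have Pl: "T * mat_adjoint T \<in> End (?l W)"
  proof (rule EndI)
    show "amp (T * mat_adjoint T) * ?l W = ?l W * amp (T * mat_adjoint T)"
      using arg_cong[OF EndD(2)[OF P U(1)], of ?l] T U(1)
      by (simp add: map_mat_star_hom_mult map_mat_star_hom_amp aa.star_hom_tens_left)
  qed (use T U in auto)
  have cl: "?l W \<in> carrier_mat n n" "?r W \<in> carrier_mat n n" using U(1) by auto
  have intl: "compress T (?l W) * amp (mat_adjoint T) = amp (mat_adjoint T) * ?l W"
    using compress_intertwines(2)[OF T cl(1) iso Pl] .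
  note csb = T amp_closed[OF T, where 'a='b] amp_closed[OF S, where 'a='b] cl
  have cll: "compress T (?l W) \<in> carrier_mat d d" using T cl by (intro compress_closed)
  have "compress T (?l W) * compress T (?r W) = (compress T (?l W) * amp (mat_adjoint T)) * (?r W * amp T)"
    unfolding compress_def[of T "?r W"] using csb cll
    by (simp add: mat_assoc)
  also have "\<dots> = compress T (?l W * ?r W)"
    unfolding intl unfolding compress_def using csb
    by (simp add: mat_assoc)
  finally have 3: "map_mat \<Delta> ?A = ?l ?A * ?r ?A"
    by (simp add: hom comult_hom aa.star_hom_tens_left aa.star_hom_tens_right rep)
  show ?thesis by (rule unitary_representationI[OF A d 1 2 3])
qed

section \<open>Spherical weights and tensor products\<close>

lemma sum_div_mod:
  fixes f :: "nat \<Rightarrow> nat \<Rightarrow> 'b::comm_monoid_add"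
  shows "(\<Sum>t<n * m. f (t div m) (t mod m)) = (\<Sum>i<n. \<Sum>k<m. f i k)"
proof (cases "m = 0")
  case False
  then have lt: "i * m + k < n * m" if "i < n" "k < m" for i k
    using that by (metis add.commute add_less_mono1 less_le_trans mult_Suc mult_le_mono1 Suc_leI)
  have "(\<Sum>(i, k)\<in>{..<n} \<times> {..<m}. f i k) = (\<Sum>t<n * m. f (t div m) (t mod m))"
    by (rule sum.reindex_bij_witness[of _ "\<lambda>t. (t div m, t mod m)" "\<lambda>(i, k). i * m + k"])
      (use False in \<open>auto simp: less_mult_imp_div_less lt\<close>)
  then show ?thesis by (simp add: sum.cartesian_product)
qed simp

lemma sum_rotate3:
  "(\<Sum>k\<in>K. \<Sum>a\<in>A. \<Sum>b\<in>B. f k a b) = (\<Sum>a\<in>A. \<Sum>b\<in>B. \<Sum>k\<in>K. f k a b)"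
  by (subst sum.swap) (rule sum.cong[OF refl], rule sum.swap)

lemma sum_rotate4:
  "(\<Sum>k\<in>K. \<Sum>a\<in>A. \<Sum>b\<in>B. \<Sum>c\<in>C. f k a b c) = (\<Sum>a\<in>A. \<Sum>b\<in>B. \<Sum>c\<in>C. \<Sum>k\<in>K. f k a b c)"
  by (subst sum.swap) (rule sum.cong[OF refl], rule sum_rotate3)

text \<open>All orthogonality relations of a tensor product have this shape: the inner factor sums to a scalar, which leaves the relation of the outer factor.\<close>

lemma nested_product_sum:
  fixes x x' y y' :: "nat \<Rightarrow> 'a::unital_cstar_algebra"
  assumes "(\<Sum>k<m. y k * y' k) = c *\<^sub>C 1"
  shows "(\<Sum>i<n. \<Sum>k<m. (x i * y k) * (y' k * x' i)) = c *\<^sub>C (\<Sum>i<n. x i * x' i)"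
proof -
  have "(\<Sum>k<m. (x i * y k) * (y' k * x' i)) = c *\<^sub>C (x i * x' i)" for i
  proof -
    have "(\<Sum>k<m. (x i * y k) * (y' k * x' i)) = x i * (\<Sum>k<m. y k * y' k) * x' i"
      by (simp add: sum_distrib_left sum_distrib_right mult.assoc)
    then show ?thesis by (simp add: assms mult_scaleC_left mult_scaleC_right)
  qed
  then show ?thesis by (simp add: cspace.scale_sum_right)
qed

lemma tensor_rep_dim [simp]:
  "dim_row (tensor_rep U V) = dim_row U * dim_row V" "dim_col (tensor_rep U V) = dim_col U * dim_col V"
  by (simp_all add: tensor_rep_def)

lemma tensor_rep_index [simp]:
  assumes "r < dim_row U * dim_row V" "s < dim_col U * dim_col V"
  shows "tensor_rep U V $$ (r, s) =
    U $$ (r div dim_row V, s div dim_col V) * V $$ (r mod dim_row V, s mod dim_col V)"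
  using assms by (simp add: tensor_rep_def)

lemma div_mod_eq_iff: "(r :: nat) = s \<longleftrightarrow> r div m = s div m \<and> r mod m = s mod m"
  by (metis mult_div_mod_eq)

lemma unitary_entries:
  assumes "W \<in> carrier_mat n n" "star_mat W * W = 1\<^sub>m n" "W * star_mat W = 1\<^sub>m n" "i < n" "j < n"
  shows "(\<Sum>k<n. star (W $$ (k, i)) * W $$ (k, j)) = (if i = j then 1 else 0) *\<^sub>C 1"
    "(\<Sum>k<n. W $$ (i, k) * star (W $$ (j, k))) = (if i = j then 1 else 0) *\<^sub>C 1"
proof -
  have "(star_mat W * W) $$ (i, j) = (\<Sum>k<n. star (W $$ (k, i)) * W $$ (k, j))"
    "(W * star_mat W) $$ (i, j) = (\<Sum>k<n. W $$ (i, k) * star (W $$ (j, k)))"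
    using assms(1,4,5) by (simp_all add: mat_mult_index)
  then show "(\<Sum>k<n. star (W $$ (k, i)) * W $$ (k, j)) = (if i = j then 1 else 0) *\<^sub>C 1"
    "(\<Sum>k<n. W $$ (i, k) * star (W $$ (j, k))) = (if i = j then 1 else 0) *\<^sub>C 1"
    using assms by auto
qed

text \<open>Elementary tensors in different legs commute, so the comultiplication of \<open>u v\<close> regroups into a product of entries of the tensor product.\<close>

lemma tensor_unitary_representation:
  fixes U V :: "'a::unital_cstar_algebra mat"
  assumes cqg: "compact_quantum_group tens tens_l tens_r \<Delta>"
    and repU: "unitary_representation tens \<Delta> U" and repV: "unitary_representation tens \<Delta> V"
  shows "unitary_representation tens \<Delta> (tensor_rep U V)"
proof -
  interpret compact_quantum_group tens tens_l tens_r \<Delta> by fact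
  define n m where "n = dim_row U" and "m = dim_row V"
  note U = unitary_representationD[OF repU, folded n_def] and V = unitary_representationD[OF repV, folded m_def]
  let ?W = "tensor_rep U V"
  have dims: "dim_row U = n" "dim_col U = n" "dim_row V = m" "dim_col V = m" using U V by auto
  have W: "?W \<in> carrier_mat (n * m) (n * m)" by (rule carrier_matI) (simp_all add: dims)
  have m: "m > 0" by fact
  have divmod: "r div m < n" "r mod m < m" if "r < n * m" for r
    using that m by (auto simp: less_mult_imp_div_less)
  have 1: "star_mat ?W * ?W = 1\<^sub>m (n * m)"
  proof (rule eq_matI)
    fix r s assume "r < dim_row (1\<^sub>m (n * m) :: 'a mat)" "s < dim_col (1\<^sub>m (n * m) :: 'a mat)"
    then have r: "r < n * m" and s: "s < n * m" by auto
    have "(star_mat ?W * ?W) $$ (r, s) =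
      (\<Sum>t<n * m. (star (V $$ (t mod m, r mod m)) * star (U $$ (t div m, r div m))) *
                   (U $$ (t div m, s div m) * V $$ (t mod m, s mod m)))"
      using r s by (simp add: mat_mult_index dims star_mult)
    also have "\<dots> = (\<Sum>k<m. \<Sum>i<n. (star (V $$ (k, r mod m)) * star (U $$ (i, r div m))) *
                   (U $$ (i, s div m) * V $$ (k, s mod m)))"
      by (subst sum_div_mod) (rule sum.swap)
    also have "\<dots> = (if r div m = s div m then 1 else 0) *\<^sub>C (if r mod m = s mod m then 1 else 0) *\<^sub>C 1"
      by (subst nested_product_sum, rule unitary_entries(1)[OF U(1) U(3) U(4)])
         (use divmod r s in \<open>simp_all add: unitary_entries(1)[OF V(1) V(3) V(4)]\<close>)
    finally show "(star_mat ?W * ?W) $$ (r, s) = 1\<^sub>m (n * m) $$ (r, s)"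
      using r s div_mod_eq_iff[of r s m] by auto
  qed (use W in auto)
  have 2: "?W * star_mat ?W = 1\<^sub>m (n * m)"
  proof (rule eq_matI)
    fix r s assume "r < dim_row (1\<^sub>m (n * m) :: 'a mat)" "s < dim_col (1\<^sub>m (n * m) :: 'a mat)"
    then have r: "r < n * m" and s: "s < n * m" by auto
    have "(?W * star_mat ?W) $$ (r, s) =
      (\<Sum>t<n * m. (U $$ (r div m, t div m) * V $$ (r mod m, t mod m)) *
         (star (V $$ (s mod m, t mod m)) * star (U $$ (s div m, t div m))))"
      using r s by (simp add: mat_mult_index dims star_mult)
    also have "\<dots> = (\<Sum>i<n. \<Sum>k<m. (U $$ (r div m, i) * V $$ (r mod m, k)) *
         (star (V $$ (s mod m, k)) * star (U $$ (s div m, i))))"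
      by (rule sum_div_mod)
    also have "\<dots> = (if r mod m = s mod m then 1 else 0) *\<^sub>C (if r div m = s div m then 1 else 0) *\<^sub>C 1"
      by (subst nested_product_sum, rule unitary_entries(2)[OF V(1) V(3) V(4)])
         (use divmod r s in \<open>simp_all add: unitary_entries(2)[OF U(1) U(3) U(4)]\<close>)
    finally show "(?W * star_mat ?W) $$ (r, s) = 1\<^sub>m (n * m) $$ (r, s)"
      using r s div_mod_eq_iff[of r s m] by auto
  qed (use W in auto)
  let ?l = "\<lambda>a. tens a 1" and ?r = "\<lambda>a. tens 1 a"
  have comult: "\<Delta> (R $$ (i, j)) = (\<Sum>k<p. ?l (R $$ (i, k)) * ?r (R $$ (k, j)))"
    if "unitary_representation tens \<Delta> R" "R \<in> carrier_mat p p" "i < p" "j < p" for R p i j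
  proof -
    have "map_mat \<Delta> R = map_mat ?l R * map_mat ?r R"
      using that(1) by (simp add: unitary_representation_def representation_def)
    from arg_cong[OF this, of "\<lambda>M. M $$ (i, j)"] show ?thesis
      using that by (simp add: mat_mult_index)
  qed
  have \<Delta>_mult: "\<Delta> (x * y) = \<Delta> x * \<Delta> y" for x y using comult_hom by (simp add: star_hom_def)
  have 3: "map_mat \<Delta> ?W = map_mat ?l ?W * map_mat ?r ?W"
  proof (rule eq_matI)
    fix r s assume "r < dim_row (map_mat ?l ?W * map_mat ?r ?W)" "s < dim_col (map_mat ?l ?W * map_mat ?r ?W)"
    then have r: "r < n * m" and s: "s < n * m" by (auto simp: dims)
    have "map_mat \<Delta> ?W $$ (r, s) = \<Delta> (U $$ (r div m, s div m)) * \<Delta> (V $$ (r mod m, s mod m))"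
      using r s by (simp add: dims \<Delta>_mult)
    also have "\<dots> = (\<Sum>i<n. \<Sum>k<m. (?l (U $$ (r div m, i)) * ?r (U $$ (i, s div m))) *
        (?l (V $$ (r mod m, k)) * ?r (V $$ (k, s mod m))))"
      using divmod[OF r] divmod[OF s]
      by (simp only: comult[OF repU U(1)] comult[OF repV V(1)] sum_product)
    also have "\<dots> = (\<Sum>i<n. \<Sum>k<m. ?l (U $$ (r div m, i) * V $$ (r mod m, k)) *
        ?r (U $$ (i, s div m) * V $$ (k, s mod m)))"
      by (simp add: aa.tens_mult)
    also have "\<dots> = (\<Sum>t<n * m. ?l (U $$ (r div m, t div m) * V $$ (r mod m, t mod m)) *
        ?r (U $$ (t div m, s div m) * V $$ (t mod m, s mod m)))"
      by (rule sum_div_mod[symmetric])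
    also have "\<dots> = (map_mat ?l ?W * map_mat ?r ?W) $$ (r, s)"
      using r s by (simp add: mat_mult_index dims)
    finally show "map_mat \<Delta> ?W $$ (r, s) = (map_mat ?l ?W * map_mat ?r ?W) $$ (r, s)" .
  qed (use W in auto)
  show ?thesis
    by (rule unitary_representationI[OF W _ 1 2 3]) (use U V in simp)
qed

lemma trivial_unitary_representation:
  fixes tens :: "'a::unital_cstar_algebra \<Rightarrow> 'a \<Rightarrow> 'b::unital_cstar_algebra"
  assumes cqg: "compact_quantum_group tens tens_l tens_r \<Delta>"
  shows "unitary_representation tens \<Delta> (1\<^sub>m 1)"
proof -
  interpret compact_quantum_group tens tens_l tens_r \<Delta> by fact
  have s: "star_mat (1\<^sub>m 1) = (1\<^sub>m 1 :: 'a mat)" by (rule eq_matI) auto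
  have "map_mat f (1\<^sub>m 1) = (1\<^sub>m 1 :: 'b mat)" if "star_hom f" for f :: "'a \<Rightarrow> 'b"
    using map_mat_star_hom_amp[OF that, of "1\<^sub>m 1"] by simp
  then show ?thesis
    by (intro unitary_representationI[of _ 1])
      (simp_all add: s[simplified] comult_hom aa.star_hom_tens_left aa.star_hom_tens_right)
qed

text \<open>Membership in \<open>End W\<close>, written as equations between entries of \<open>W\<close>, because the tensor product and the conjugate of \<open>W\<close> are only accessible through their entries.\<close>

lemma End_entries:
  assumes "X \<in> carrier_mat n n" "W \<in> carrier_mat n n"
  shows "X \<in> End W \<longleftrightarrow>
    (\<forall>i<n. \<forall>j<n. (\<Sum>k<n. X $$ (i, k) *\<^sub>C W $$ (k, j)) = (\<Sum>k<n. X $$ (k, j) *\<^sub>C W $$ (i, k)))"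
proof -
  have "X \<in> End W \<longleftrightarrow> amp X * W = W * amp X" using assms by (auto simp: Mor_def)
  also have "\<dots> \<longleftrightarrow> (\<forall>i<n. \<forall>j<n. (amp X * W) $$ (i, j) = (W * amp X) $$ (i, j))"
    using assms by (auto simp: mat_eq_iff)
  also have "\<dots> \<longleftrightarrow> (\<forall>i<n. \<forall>j<n. (\<Sum>k<n. X $$ (i, k) *\<^sub>C W $$ (k, j)) = (\<Sum>k<n. X $$ (k, j) *\<^sub>C W $$ (i, k)))"
    using assms by (simp add: mat_mult_index mult_scaleC_left mult_scaleC_right)
  finally show ?thesis .
qed

text \<open>The operator \<open>\<rho>\<close> in an eigenbasis with eigenvalues \<open>r i\<close>.  The two families of orthogonality relations say that
  \<open>\<rho> W (1/\<rho>)\<close> is the transpose of a two-sided inverse of the entrywise adjoint of \<open>W\<close>, that is, that \<open>\<rho>\<close> intertwines \<open>W\<close> with its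
  double contragredient.  In this form no contragredient of a tensor product has to be formed.\<close>

definition spherical_weights :: "'a::unital_cstar_algebra mat \<Rightarrow> (nat \<Rightarrow> real) \<Rightarrow> bool" where
  "spherical_weights W r \<longleftrightarrow>
     (\<forall>i<dim_row W. 0 < r i) \<and>
     (\<forall>j<dim_row W. \<forall>k<dim_row W.
        (\<Sum>i<dim_row W. (complex_of_real (r i) *\<^sub>C W $$ (i, j)) * star (W $$ (i, k))) =
        (if j = k then complex_of_real (r j) else 0) *\<^sub>C 1) \<and>
     (\<forall>j<dim_row W. \<forall>k<dim_row W.
        (\<Sum>i<dim_row W. (complex_of_real (1 / r i) *\<^sub>C star (W $$ (j, i))) * W $$ (k, i)) =
        (if j = k then complex_of_real (1 / r j) else 0) *\<^sub>C 1) \<and>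
     (\<forall>X\<in>End W. (\<Sum>i<dim_row W. X $$ (i, i) * complex_of_real (r i)) =
                 (\<Sum>i<dim_row W. X $$ (i, i) * complex_of_real (1 / r i)))"

text \<open>The orthogonality relations multiply.  For the trace condition, the partial trace of an intertwiner over the second
  factor, weighted by \<open>s\<close>, lies in \<open>End U\<close> by the first family of relations for \<open>V\<close>, and the partial trace over the first factor, weighted by
  \<open>1 / r\<close>, lies in \<open>End V\<close> by the second family for \<open>U\<close>.  So the weights of the first factor can be inverted, and then those of the second.\<close>

lemma spherical_weights_tensor:
  fixes U V :: "'a::unital_cstar_algebra mat"
  assumes U: "U \<in> carrier_mat n n" "star_mat U * U = 1\<^sub>m n" "U * star_mat U = 1\<^sub>m n"
    and V: "V \<in> carrier_mat m m" "star_mat V * V = 1\<^sub>m m" "V * star_mat V = 1\<^sub>m m"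
    and r: "spherical_weights U r" and s: "spherical_weights V s" and m: "m > 0"
  shows "spherical_weights (tensor_rep U V) (\<lambda>t. r (t div m) * s (t mod m))"
proof -
  let ?W = "tensor_rep U V"
  define u where "u i j = U $$ (i, j)" for i j
  define v where "v i j = V $$ (i, j)" for i j
  define R where "R i = complex_of_real (r i)" for i
  define S where "S i = complex_of_real (s i)" for i
  define R' where "R' i = complex_of_real (1 / r i)" for i
  define S' where "S' i = complex_of_real (1 / s i)" for i
  have dims: "dim_row U = n" "dim_col U = n" "dim_row V = m" "dim_col V = m" using U V by auto
  have W: "?W \<in> carrier_mat (n * m) (n * m)" by (rule carrier_matI) (simp_all add: dims)
  have divmod: "t div m < n" "t mod m < m" if "t < n * m" for t
    using that m by (auto simp: less_mult_imp_div_less)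
  note r = r[unfolded spherical_weights_def dims, folded u_def R_def R'_def]
  note s = s[unfolded spherical_weights_def dims, folded v_def S_def S'_def]
  have Au: "(\<Sum>i<n. (R i *\<^sub>C u i j) * star (u i k)) = (if j = k then R j else 0) *\<^sub>C 1" if "j < n" "k < n" for j k
    using r that by blast
  have Bu: "(\<Sum>i<n. (R' i *\<^sub>C star (u j i)) * u k i) = (if j = k then R' j else 0) *\<^sub>C 1" if "j < n" "k < n" for j k
    using r that by blast
  have Av: "(\<Sum>i<m. (S i *\<^sub>C v i j) * star (v i k)) = (if j = k then S j else 0) *\<^sub>C 1" if "j < m" "k < m" for j k
    using s that by blast
  have Bv: "(\<Sum>i<m. (S' i *\<^sub>C star (v j i)) * v k i) = (if j = k then S' j else 0) *\<^sub>C 1" if "j < m" "k < m" for j k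
    using s that by blast
  have W_index: "?W $$ (a, b) = u (a div m) (b div m) * v (a mod m) (b mod m)" if "a < n * m" "b < n * m" for a b
    using that by (simp add: dims u_def v_def)
  have 1: "(\<Sum>t<n * m. (complex_of_real (r (t div m) * s (t mod m)) *\<^sub>C ?W $$ (t, j)) * star (?W $$ (t, k))) =
      (if j = k then complex_of_real (r (j div m) * s (j mod m)) else 0) *\<^sub>C 1"
    if j: "j < n * m" and k: "k < n * m" for j k
  proof -
    have "(\<Sum>t<n * m. (complex_of_real (r (t div m) * s (t mod m)) *\<^sub>C ?W $$ (t, j)) * star (?W $$ (t, k))) =
      (\<Sum>t<n * m. ((R (t div m) *\<^sub>C u (t div m) (j div m)) * (S (t mod m) *\<^sub>C v (t mod m) (j mod m))) *
        (star (v (t mod m) (k mod m)) * star (u (t div m) (k div m))))"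
      using j k by (intro sum.cong)
        (simp_all add: W_index star_mult mult_scaleC_left mult_scaleC_right scaleC_scaleC R_def S_def mult.assoc)
    also have "\<dots> = (\<Sum>i<n. \<Sum>l<m. ((R i *\<^sub>C u i (j div m)) * (S l *\<^sub>C v l (j mod m))) *
        (star (v l (k mod m)) * star (u i (k div m))))"
      by (rule sum_div_mod)
    also have "\<dots> = (if j mod m = k mod m then S (j mod m) else 0) *\<^sub>C (if j div m = k div m then R (j div m) else 0) *\<^sub>C 1"
      by (subst nested_product_sum, rule Av)
         (use divmod j k in \<open>simp_all only: Au\<close>)
    finally show ?thesis
      using div_mod_eq_iff[of j k m] by (auto simp: scaleC_scaleC R_def S_def mult.commute)
  qed
  have 2: "(\<Sum>t<n * m. (complex_of_real (1 / (r (t div m) * s (t mod m))) *\<^sub>C star (?W $$ (j, t))) * ?W $$ (k, t)) =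
      (if j = k then complex_of_real (1 / (r (j div m) * s (j mod m))) else 0) *\<^sub>C 1"
    if j: "j < n * m" and k: "k < n * m" for j k
  proof -
    have "(\<Sum>t<n * m. (complex_of_real (1 / (r (t div m) * s (t mod m))) *\<^sub>C star (?W $$ (j, t))) * ?W $$ (k, t)) =
      (\<Sum>t<n * m. ((S' (t mod m) *\<^sub>C star (v (j mod m) (t mod m))) * (R' (t div m) *\<^sub>C star (u (j div m) (t div m)))) *
        (u (k div m) (t div m) * v (k mod m) (t mod m)))"
      using j k by (intro sum.cong)
        (simp_all add: W_index star_mult mult_scaleC_left mult_scaleC_right scaleC_scaleC R'_def S'_def mult.assoc mult.commute)
    also have "\<dots> = (\<Sum>l<m. \<Sum>i<n. ((S' l *\<^sub>C star (v (j mod m) l)) * (R' i *\<^sub>C star (u (j div m) i))) *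
        (u (k div m) i * v (k mod m) l))"
      by (subst sum_div_mod) (rule sum.swap)
    also have "\<dots> = (if j div m = k div m then R' (j div m) else 0) *\<^sub>C (if j mod m = k mod m then S' (j mod m) else 0) *\<^sub>C 1"
      by (subst nested_product_sum, rule Bu)
         (use divmod j k in \<open>simp_all only: Bv\<close>)
    finally show ?thesis
      using div_mod_eq_iff[of j k m] by (auto simp: scaleC_scaleC R'_def S'_def)
  qed
  have 3: "(\<Sum>t<n * m. X $$ (t, t) * complex_of_real (r (t div m) * s (t mod m))) =
      (\<Sum>t<n * m. X $$ (t, t) * complex_of_real (1 / (r (t div m) * s (t mod m))))" if X: "X \<in> End ?W" for X
  proof -
    note XW = EndD[OF X W]
    define x where "x i k j l = X $$ (i * m + k, j * m + l)" for i k j l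
    have lt: "i * m + k < n * m" if "i < n" "k < m" for i k
      using that by (metis add.commute add_less_mono1 less_le_trans mult_Suc mult_le_mono1 Suc_leI)
    \<comment> \<open>The commutation of \<open>X\<close> with \<open>U \<otimes> V\<close>, in entries.  Cancelling the entries of \<open>V\<close> from the right gives the statement on \<open>E\<close>, cancelling those of \<open>U\<close> from the left the one on \<open>F\<close>.\<close>
    have comm: "(\<Sum>j<n. \<Sum>l<m. x i k j l *\<^sub>C (u j j' * v l l')) = (\<Sum>j<n. \<Sum>l<m. x j l j' l' *\<^sub>C (u i j * v k l))"
      if "i < n" "k < m" "j' < n" "l' < m" for i k j' l'
    proof -
      have "(\<Sum>t<n * m. X $$ (i * m + k, t) *\<^sub>C ?W $$ (t, j' * m + l')) =
            (\<Sum>t<n * m. X $$ (t, j' * m + l') *\<^sub>C ?W $$ (i * m + k, t))"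
        using X End_entries[OF XW(1) W] lt that by blast
      then have "(\<Sum>t<n * m. x i k (t div m) (t mod m) *\<^sub>C (u (t div m) j' * v (t mod m) l')) =
            (\<Sum>t<n * m. x (t div m) (t mod m) j' l' *\<^sub>C (u i (t div m) * v k (t mod m)))"
        using that by (simp add: W_index lt x_def)
      then show ?thesis
        using sum_div_mod[of "\<lambda>j l. x i k j l *\<^sub>C (u j j' * v l l')" m n]
          sum_div_mod[of "\<lambda>j l. x j l j' l' *\<^sub>C (u i j * v k l)" m n] by simp
    qed
    have tr: "(\<Sum>t<n * m. X $$ (t, t) * (f (t div m) * g (t mod m))) = (\<Sum>i<n. \<Sum>k<m. x i k i k * (f i * g k))"
      for f g
      using sum_div_mod[of "\<lambda>i k. x i k i k * (f i * g k)" m n] by (simp add: x_def)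
    define E where "E = mat n n (\<lambda>(i, j). \<Sum>k<m. x i k j k * S k)"
    have E: "E \<in> End U"
    proof (subst End_entries[of _ n], safe)
      fix i j' assume i: "i < n" and j': "j' < n"
      have "(\<Sum>j<n. E $$ (i, j) *\<^sub>C U $$ (j, j')) = (\<Sum>k<m. \<Sum>j<n. S k *\<^sub>C x i k j k *\<^sub>C u j j')"
        using i by (subst sum.swap) (simp add: E_def u_def cspace.scale_sum_left scaleC_scaleC mult.commute)
      also have "\<dots> = (\<Sum>k<m. S k *\<^sub>C (\<Sum>l'<m. (\<Sum>j<n. \<Sum>l<m. x i k j l *\<^sub>C (u j j' * v l l')) * star (v k l')))"
      proof (rule sum.cong[OF refl])
        fix k assume "k \<in> {..<m}"
        then have k: "k < m" by simp
        have "(\<Sum>l'<m. (\<Sum>j<n. \<Sum>l<m. x i k j l *\<^sub>C (u j j' * v l l')) * star (v k l')) =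
          (\<Sum>l'<m. \<Sum>j<n. \<Sum>l<m. x i k j l *\<^sub>C (u j j' * (v l l' * star (v k l'))))"
          by (simp add: sum_distrib_right mult_scaleC_left mult.assoc)
        also have "\<dots> = (\<Sum>j<n. \<Sum>l<m. \<Sum>l'<m. x i k j l *\<^sub>C (u j j' * (v l l' * star (v k l'))))"
          by (rule sum_rotate3)
        also have "\<dots> = (\<Sum>j<n. \<Sum>l<m. x i k j l *\<^sub>C (u j j' * (\<Sum>l'<m. v l l' * star (v k l'))))"
          by (simp add: sum_distrib_left cspace.scale_sum_right)
        also have "\<dots> = (\<Sum>j<n. \<Sum>l<m. if l = k then x i k j l *\<^sub>C u j j' else 0)"
          using k by (intro sum.cong refl)
            (simp add: v_def unitary_entries(2)[OF V] mult_scaleC_right)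
        also have "\<dots> = (\<Sum>j<n. x i k j k *\<^sub>C u j j')"
          using k by (simp add: sum.delta)
        finally show "(\<Sum>j<n. S k *\<^sub>C x i k j k *\<^sub>C u j j') =
          S k *\<^sub>C (\<Sum>l'<m. (\<Sum>j<n. \<Sum>l<m. x i k j l *\<^sub>C (u j j' * v l l')) * star (v k l'))"
          by (simp add: cspace.scale_sum_right)
      qed
      also have "\<dots> = (\<Sum>k<m. S k *\<^sub>C (\<Sum>l'<m. (\<Sum>j<n. \<Sum>l<m. x j l j' l' *\<^sub>C (u i j * v k l)) * star (v k l')))"
        by (rule sum.cong[OF refl]) (simp add: comm i j')
      also have "\<dots> = (\<Sum>k<m. \<Sum>l'<m. \<Sum>j<n. \<Sum>l<m. x j l j' l' *\<^sub>C (u i j * ((S k *\<^sub>C v k l) * star (v k l'))))"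
        by (simp add: sum_distrib_right cspace.scale_sum_right mult_scaleC_left mult_scaleC_right scaleC_scaleC mult.assoc mult.commute[of "S _"])
      also have "\<dots> = (\<Sum>l'<m. \<Sum>j<n. \<Sum>l<m. x j l j' l' *\<^sub>C (u i j * (\<Sum>k<m. (S k *\<^sub>C v k l) * star (v k l'))))"
        by (subst sum_rotate4) (simp add: sum_distrib_left cspace.scale_sum_right)
      also have "\<dots> = (\<Sum>l'<m. \<Sum>j<n. \<Sum>l<m. if l = l' then (x j l j' l' * S l) *\<^sub>C u i j else 0)"
        by (intro sum.cong refl) (simp add: Av mult_scaleC_right scaleC_scaleC)
      also have "\<dots> = (\<Sum>l'<m. \<Sum>j<n. (x j l' j' l' * S l') *\<^sub>C u i j)"
        by (simp add: sum.delta)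
      also have "\<dots> = (\<Sum>j<n. E $$ (j, j') *\<^sub>C U $$ (i, j))"
        using j' by (subst sum.swap) (simp add: E_def u_def cspace.scale_sum_left)
      finally show "(\<Sum>j<n. E $$ (i, j) *\<^sub>C U $$ (j, j')) = (\<Sum>j<n. E $$ (j, j') *\<^sub>C U $$ (i, j))" .
    qed (simp_all add: E_def U)
    define F where "F = mat m m (\<lambda>(k, l). \<Sum>i<n. x i k i l * R' i)"
    have F: "F \<in> End V"
    proof (subst End_entries[of _ m], safe)
      fix k l' assume k: "k < m" and l': "l' < m"
      have "(\<Sum>l<m. F $$ (l, l') *\<^sub>C V $$ (k, l)) = (\<Sum>j'<n. \<Sum>l<m. R' j' *\<^sub>C x j' l j' l' *\<^sub>C v k l)"
        using l' by (subst sum.swap) (simp add: F_def v_def cspace.scale_sum_left scaleC_scaleC mult.commute)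
      also have "\<dots> = (\<Sum>j'<n. R' j' *\<^sub>C (\<Sum>i<n. star (u i j') * (\<Sum>j<n. \<Sum>l<m. x j l j' l' *\<^sub>C (u i j * v k l))))"
      proof (rule sum.cong[OF refl])
        fix j' assume "j' \<in> {..<n}"
        then have j': "j' < n" by simp
        have "(\<Sum>i<n. star (u i j') * (\<Sum>j<n. \<Sum>l<m. x j l j' l' *\<^sub>C (u i j * v k l))) =
          (\<Sum>i<n. \<Sum>j<n. \<Sum>l<m. x j l j' l' *\<^sub>C ((star (u i j') * u i j) * v k l))"
          by (simp add: sum_distrib_left mult_scaleC_right mult.assoc)
        also have "\<dots> = (\<Sum>j<n. \<Sum>l<m. \<Sum>i<n. x j l j' l' *\<^sub>C ((star (u i j') * u i j) * v k l))"
          by (rule sum_rotate3)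
        also have "\<dots> = (\<Sum>j<n. \<Sum>l<m. x j l j' l' *\<^sub>C ((\<Sum>i<n. star (u i j') * u i j) * v k l))"
          by (simp add: sum_distrib_right cspace.scale_sum_right)
        also have "\<dots> = (\<Sum>j<n. if j = j' then \<Sum>l<m. x j l j' l' *\<^sub>C v k l else 0)"
          using j' by (intro sum.cong refl)
            (simp add: u_def unitary_entries(1)[OF U] mult_scaleC_left)
        also have "\<dots> = (\<Sum>l<m. x j' l j' l' *\<^sub>C v k l)"
          using j' by (simp add: sum.delta)
        finally show "(\<Sum>l<m. R' j' *\<^sub>C x j' l j' l' *\<^sub>C v k l) =
          R' j' *\<^sub>C (\<Sum>i<n. star (u i j') * (\<Sum>j<n. \<Sum>l<m. x j l j' l' *\<^sub>C (u i j * v k l)))"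
          by (simp add: cspace.scale_sum_right)
      qed
      also have "\<dots> = (\<Sum>j'<n. R' j' *\<^sub>C (\<Sum>i<n. star (u i j') * (\<Sum>j<n. \<Sum>l<m. x i k j l *\<^sub>C (u j j' * v l l'))))"
        by (rule sum.cong[OF refl]) (simp add: comm k l')
      also have "\<dots> = (\<Sum>j'<n. \<Sum>i<n. \<Sum>j<n. \<Sum>l<m. x i k j l *\<^sub>C (((R' j' *\<^sub>C star (u i j')) * u j j') * v l l'))"
        by (simp add: sum_distrib_left cspace.scale_sum_right mult_scaleC_left mult_scaleC_right scaleC_scaleC mult.assoc mult.commute[of "R' _"])
      also have "\<dots> = (\<Sum>i<n. \<Sum>j<n. \<Sum>l<m. x i k j l *\<^sub>C ((\<Sum>j'<n. (R' j' *\<^sub>C star (u i j')) * u j j') * v l l'))"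
        by (subst sum_rotate4) (simp add: sum_distrib_right cspace.scale_sum_right)
      also have "\<dots> = (\<Sum>i<n. \<Sum>j<n. if i = j then \<Sum>l<m. (x i k j l * R' i) *\<^sub>C v l l' else 0)"
        by (intro sum.cong refl, subst Bu) (simp_all add: mult_scaleC_left scaleC_scaleC)
      also have "\<dots> = (\<Sum>i<n. \<Sum>l<m. (x i k i l * R' i) *\<^sub>C v l l')"
        by (simp add: sum.delta')
      also have "\<dots> = (\<Sum>l<m. F $$ (k, l) *\<^sub>C V $$ (l, l'))"
        using k by (subst sum.swap) (simp add: F_def v_def cspace.scale_sum_left)
      finally show "(\<Sum>l<m. F $$ (k, l) *\<^sub>C V $$ (l, l')) = (\<Sum>l<m. F $$ (l, l') *\<^sub>C V $$ (k, l))" by simp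
    qed (simp_all add: F_def V)
    have "(\<Sum>t<n * m. X $$ (t, t) * complex_of_real (r (t div m) * s (t mod m))) =
        (\<Sum>i<n. \<Sum>k<m. x i k i k * (R i * S k))"
      using tr[of R S] by (simp add: R_def S_def)
    also have "\<dots> = (\<Sum>i<n. E $$ (i, i) * R i)"
      by (simp add: E_def sum_distrib_left ac_simps)
    also have "\<dots> = (\<Sum>i<n. E $$ (i, i) * R' i)" using r E by blast
    also have "\<dots> = (\<Sum>i<n. \<Sum>k<m. x i k i k * R' i * S k)"
      by (simp add: E_def sum_distrib_left ac_simps)
    also have "\<dots> = (\<Sum>k<m. F $$ (k, k) * S k)"
      by (subst sum.swap) (simp add: F_def sum_distrib_right)
    also have "\<dots> = (\<Sum>k<m. F $$ (k, k) * S' k)" using s F by blast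
    also have "\<dots> = (\<Sum>i<n. \<Sum>k<m. x i k i k * (R' i * S' k))"
      by (subst sum.swap) (simp add: F_def sum_distrib_left ac_simps)
    also have "\<dots> = (\<Sum>t<n * m. X $$ (t, t) * complex_of_real (1 / (r (t div m) * s (t mod m))))"
      using tr[of R' S'] by (simp add: R'_def S'_def)
    finally show ?thesis .
  qed
  have "\<forall>t<n * m. 0 < r (t div m) * s (t mod m)"
    using r s divmod by simp
  with 1 2 3 show ?thesis
    unfolding spherical_weights_def by (simp only: tensor_rep_dim dims) blast
qed

lemma spherical_weights_trivial: "spherical_weights (1\<^sub>m 1 :: 'a::unital_cstar_algebra mat) (\<lambda>_. 1)"
  by (simp add: spherical_weights_def)

section \<open>Weighted traces of intertwiners\<close>

lemma End_mult:
  assumes "X \<in> End W" "Y \<in> End W" "W \<in> carrier_mat n n"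
  shows "X * Y \<in> End W"
proof (rule EndI[OF _ assms(3)])
  note X = EndD[OF assms(1,3)] and Y = EndD[OF assms(2,3)]
  show "X * Y \<in> carrier_mat n n" using X(1) Y(1) by simp
  have "amp (X * Y) * W = amp X * (amp Y * W)" using X(1) Y(1) assms(3) by (simp add: amp_mult mat_assoc)
  also have "\<dots> = (amp X * W) * amp Y" unfolding Y(2) using X(1) Y(1) assms(3) by (simp add: mat_assoc)
  also have "\<dots> = W * amp (X * Y)" unfolding X(2) using X(1) Y(1) assms(3) by (simp add: amp_mult mat_assoc)
  finally show "amp (X * Y) * W = W * amp (X * Y)" .
qed

text \<open>Unitarity of \<open>W\<close> is what makes the commutant of its coefficients closed under adjoints.\<close>

lemma End_adjoint:
  assumes X: "X \<in> End W" and W: "W \<in> carrier_mat n n" "star_mat W * W = 1\<^sub>m n" "W * star_mat W = 1\<^sub>m n"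
  shows "mat_adjoint X \<in> End W"
proof (rule EndI[OF _ W(1)])
  note X' = EndD[OF X W(1)]
  let ?Y = "mat_adjoint X" and ?S = "star_mat W"
  show "?Y \<in> carrier_mat n n" using X' by simp
  have c: "?S * amp ?Y = amp ?Y * ?S"
    using arg_cong[OF X'(2), of star_mat] X'(1) W(1) by (simp add: star_mat_mult star_mat_amp)
  have "amp ?Y * W = W * (?S * amp ?Y) * W"
    using X'(1) W by (simp flip: mat_assoc)
  also have "\<dots> = W * amp ?Y * (?S * W)" unfolding c using X'(1) W(1) by (simp add: mat_assoc)
  finally show "amp ?Y * W = W * amp ?Y" using W X'(1) by simp
qed

lemma spherical_weightsD:
  assumes "spherical_weights W r" "W \<in> carrier_mat n n"
  shows "i < n \<Longrightarrow> 0 < r i"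
    "j < n \<Longrightarrow> k < n \<Longrightarrow> (\<Sum>i<n. (complex_of_real (r i) *\<^sub>C W $$ (i, j)) * star (W $$ (i, k))) =
        (if j = k then complex_of_real (r j) else 0) *\<^sub>C 1"
    "j < n \<Longrightarrow> k < n \<Longrightarrow> (\<Sum>i<n. (complex_of_real (1 / r i) *\<^sub>C star (W $$ (j, i))) * W $$ (k, i)) =
        (if j = k then complex_of_real (1 / r j) else 0) *\<^sub>C 1"
    "X \<in> End W \<Longrightarrow> (\<Sum>i<n. X $$ (i, i) * complex_of_real (r i)) =
                 (\<Sum>i<n. X $$ (i, i) * complex_of_real (1 / r i))"
  using assms by (simp_all add: spherical_weights_def)

text \<open>The matrix \<open>M\<close> is the inverse of the entrywise adjoint of \<open>W\<close>.  An operator that commutes with that entrywise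
  adjoint commutes with \<open>M\<close>, and \<open>M\<close> is the transpose of \<open>\<rho> W (1/\<rho>)\<close>.\<close>

lemma End_conjugate_by_weights:
  fixes W :: "'a::unital_cstar_algebra mat"
  assumes r: "spherical_weights W r"
    and W: "W \<in> carrier_mat n n" "star_mat W * W = 1\<^sub>m n" "W * star_mat W = 1\<^sub>m n"
    and X: "X \<in> End W"
  shows "mat n n (\<lambda>(i, j). X $$ (i, j) * complex_of_real (r j / r i)) \<in> End W"
proof -
  note r = spherical_weightsD[OF r W(1)]
  define C where "C = map_mat star W"
  define M where "M = mat n n (\<lambda>(i, j). complex_of_real (r j / r i) *\<^sub>C W $$ (j, i))"
  have cC: "C \<in> carrier_mat n n" and cM: "M \<in> carrier_mat n n" using W by (auto simp: C_def M_def)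
  have pos: "r i \<noteq> 0" if "i < n" for i using r(1)[OF that] by simp
  have MC: "M * C = 1\<^sub>m n"
  proof (rule eq_matI)
    fix i j assume "i < dim_row (1\<^sub>m n :: 'a mat)" "j < dim_col (1\<^sub>m n :: 'a mat)"
    then have i: "i < n" and j: "j < n" by auto
    have "(M * C) $$ (i, j) = (\<Sum>k<n. (complex_of_real (r k / r i) *\<^sub>C W $$ (k, i)) * star (W $$ (k, j)))"
      using i j W by (simp add: mat_mult_index M_def C_def)
    also have "\<dots> = complex_of_real (1 / r i) *\<^sub>C (\<Sum>k<n. (complex_of_real (r k) *\<^sub>C W $$ (k, i)) * star (W $$ (k, j)))"
      by (simp add: cspace.scale_sum_right mult_scaleC_left scaleC_scaleC)
    finally show "(M * C) $$ (i, j) = 1\<^sub>m n $$ (i, j)"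
      using i j pos by (simp add: r(2) scaleC_scaleC)
  qed (use W in \<open>auto simp: M_def C_def\<close>)
  have CM: "C * M = 1\<^sub>m n"
  proof (rule eq_matI)
    fix i j assume "i < dim_row (1\<^sub>m n :: 'a mat)" "j < dim_col (1\<^sub>m n :: 'a mat)"
    then have i: "i < n" and j: "j < n" by auto
    have "(C * M) $$ (i, j) = (\<Sum>k<n. star (W $$ (i, k)) * (complex_of_real (r j / r k) *\<^sub>C W $$ (j, k)))"
      using i j W by (simp add: mat_mult_index M_def C_def)
    also have "\<dots> = complex_of_real (r j) *\<^sub>C (\<Sum>k<n. (complex_of_real (1 / r k) *\<^sub>C star (W $$ (i, k))) * W $$ (j, k))"
      by (simp add: cspace.scale_sum_right mult_scaleC_left mult_scaleC_right scaleC_scaleC)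
    finally show "(C * M) $$ (i, j) = 1\<^sub>m n $$ (i, j)"
      unfolding r(3)[OF i j] using i j pos by (simp add: scaleC_scaleC)
  qed (use W in \<open>auto simp: M_def C_def\<close>)
  define Z where "Z = transpose_mat X"
  have X': "X \<in> carrier_mat n n" using EndD[OF X W(1)] by simp
  have cZ: "Z \<in> carrier_mat n n" using X' by (simp add: Z_def)
  have Z: "Z \<in> End C"
  proof (subst End_entries[OF cZ cC], intro allI impI)
    fix i j assume i: "i < n" and j: "j < n"
    have "(\<Sum>k<n. mat_adjoint X $$ (i, k) *\<^sub>C W $$ (k, j)) = (\<Sum>k<n. mat_adjoint X $$ (k, j) *\<^sub>C W $$ (i, k))"
      using End_adjoint[OF X W] End_entries[of "mat_adjoint X" n W] X' W(1) i j by auto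
    from arg_cong[OF this, of star]
    show "(\<Sum>k<n. Z $$ (i, k) *\<^sub>C C $$ (k, j)) = (\<Sum>k<n. Z $$ (k, j) *\<^sub>C C $$ (i, k))"
      using i j X' W(1) by (simp add: star_sum star_scaleC Z_def C_def)
  qed
  note Z' = EndD[OF Z cC]
  have "amp Z * M = M * (C * amp Z) * M" using cZ cM cC MC by (simp flip: mat_assoc)
  also have "\<dots> = M * amp Z * (C * M)" unfolding Z'(2)[symmetric] using cZ cM cC by (simp add: mat_assoc)
  finally have "amp Z * M = M * amp Z" using CM cM cZ by simp
  then have ZM: "Z \<in> End M" by (intro EndI[OF cZ cM])
  show ?thesis
  proof (subst End_entries[of _ n], safe)
    fix j i assume j: "j < n" and i: "i < n"
    have "(\<Sum>k<n. Z $$ (i, k) *\<^sub>C M $$ (k, j)) = (\<Sum>k<n. Z $$ (k, j) *\<^sub>C M $$ (i, k))"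
      using ZM End_entries[OF cZ cM] i j by blast
    then have "(\<Sum>k<n. X $$ (k, i) *\<^sub>C complex_of_real (r j / r k) *\<^sub>C W $$ (j, k)) =
        (\<Sum>k<n. X $$ (j, k) *\<^sub>C complex_of_real (r k / r i) *\<^sub>C W $$ (k, i))"
      using i j X' by (simp add: Z_def M_def)
    from arg_cong[OF this[symmetric], of "\<lambda>x. complex_of_real (r i / r j) *\<^sub>C x"]
    show "(\<Sum>k<n. mat n n (\<lambda>(i, j). X $$ (i, j) * complex_of_real (r j / r i)) $$ (j, k) *\<^sub>C W $$ (k, i)) =
      (\<Sum>k<n. mat n n (\<lambda>(i, j). X $$ (i, j) * complex_of_real (r j / r i)) $$ (k, i) *\<^sub>C W $$ (j, k))"
      using i j pos by (simp add: cspace.scale_sum_right scaleC_scaleC mult_ac)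
  qed (use W in auto)
qed

lemma End_conjugate_by_weight_powers:
  assumes r: "spherical_weights W r"
    and W: "W \<in> carrier_mat n n" "star_mat W * W = 1\<^sub>m n" "W * star_mat W = 1\<^sub>m n"
    and X: "X \<in> End W"
  shows "mat n n (\<lambda>(i, j). X $$ (i, j) * complex_of_real ((r j / r i) ^ p)) \<in> End W"
proof (induction p)
  case 0
  have "mat n n (\<lambda>(i, j). X $$ (i, j) * complex_of_real ((r j / r i) ^ 0)) = X"
    by (rule eq_matI) (use EndD(1)[OF X W(1)] in auto)
  then show ?case using X by simp
next
  case (Suc p)
  have "mat n n (\<lambda>(i, j). mat n n (\<lambda>(i, j). X $$ (i, j) * complex_of_real ((r j / r i) ^ p)) $$ (i, j) *
      complex_of_real (r j / r i)) = mat n n (\<lambda>(i, j). X $$ (i, j) * complex_of_real ((r j / r i) ^ Suc p))"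
    by (rule eq_matI) auto
  with End_conjugate_by_weights[OF r W Suc.IH] show ?case by simp
qed

text \<open>For a trace \<open>\<phi>(X) = Tr(X \<rho>)\<close>, conjugation by \<open>\<rho>\<close> is the modular automorphism; for \<open>Tr(X (1/\<rho>))\<close> it is conjugation by the
  inverse.  As the two functionals agree on \<open>End W\<close>, the square of the automorphism is trivial, and positivity of \<open>\<rho>\<close> removes the square.
  The proof carries this out on the nonnegative numbers \<open>a i j\<close>, where \<open>q i j\<close> is the factor by which conjugation by \<open>1/\<rho>\<close> multiplies
  the entry with indices \<open>i\<close> and \<open>j\<close>.\<close>

theorem End_commutes_with_weights:
  assumes r: "spherical_weights W r"
    and W: "W \<in> carrier_mat n n" "star_mat W * W = 1\<^sub>m n" "W * star_mat W = 1\<^sub>m n"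
    and X: "X \<in> End W" and ij: "i < n" "j < n" "X $$ (i, j) \<noteq> 0"
  shows "r i = r j"
proof -
  note rD = spherical_weightsD[OF r W(1)]
  note X' = EndD[OF X W(1)]
  define a where "a i j = (cmod (X $$ (i, j)))\<^sup>2" for i j
  define q where "q i j = r j / r i" for i j
  define Y where "Y p = mat n n (\<lambda>(i, j). X $$ (i, j) * complex_of_real ((q i j) ^ p))" for p
  have Y: "Y p \<in> End W" "Y p \<in> carrier_mat n n" for p
    using End_conjugate_by_weight_powers[OF r W X] by (simp_all add: Y_def q_def)
  \<comment> \<open>The trace condition for \<open>X* Y\<close>, and below for \<open>Y X*\<close>, where \<open>Y\<close> arises from \<open>X\<close> by conjugating \<open>p\<close> times.\<close>
  have I: "(\<Sum>i<n. \<Sum>j<n. a i j * q i j ^ p * r j) = (\<Sum>i<n. \<Sum>j<n. a i j * q i j ^ p / r j)" for p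
  proof -
    have *: "(mat_adjoint X * Y p) $$ (j, j) = complex_of_real (\<Sum>i<n. a i j * q i j ^ p)" if "j < n" for j
      using that X' Y(2)[of p]
      by (simp add: mat_mult_index Y_def a_def complex_norm_square mult_ac del: of_real_power)
    have "(\<Sum>j<n. (\<Sum>i<n. a i j * q i j ^ p) * r j) = (\<Sum>j<n. (\<Sum>i<n. a i j * q i j ^ p) * (1 / r j))"
      using rD(4)[OF End_mult[OF End_adjoint[OF X W] Y(1)[of p] W(1)]]
      by (simp add: * flip: of_real_mult of_real_sum of_real_divide)
    then show ?thesis
      by (subst (1 2) sum.swap) (simp add: sum_distrib_right sum_divide_distrib)
  qed
  have J: "(\<Sum>i<n. \<Sum>j<n. a i j * q i j ^ p * r i) = (\<Sum>i<n. \<Sum>j<n. a i j * q i j ^ p / r i)" for p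
  proof -
    have *: "(Y p * mat_adjoint X) $$ (i, i) = complex_of_real (\<Sum>j<n. a i j * q i j ^ p)" if "i < n" for i
      using that X' Y(2)[of p]
      by (simp add: mat_mult_index Y_def a_def complex_norm_square mult_ac del: of_real_power)
    have "(\<Sum>i<n. (\<Sum>j<n. a i j * q i j ^ p) * r i) = (\<Sum>i<n. (\<Sum>j<n. a i j * q i j ^ p) * (1 / r i))"
      using rD(4)[OF End_mult[OF Y(1)[of p] End_adjoint[OF X W] W(1)]]
      by (simp add: * flip: of_real_mult of_real_sum of_real_divide)
    then show ?thesis by (simp add: sum_distrib_right sum_divide_distrib)
  qed
  \<comment> \<open>As \<open>q i j * r i = r j\<close>, the two families of identities combine into invariance under multiplication by the square of \<open>q\<close>.\<close>
  have shift: "(\<Sum>i<n. \<Sum>j<n. a i j * q i j ^ (p + 2) / r i) = (\<Sum>i<n. \<Sum>j<n. a i j * q i j ^ p / r i)" for p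
  proof -
    have "(\<Sum>i<n. \<Sum>j<n. a i j * q i j ^ (p + 2) / r i) = (\<Sum>i<n. \<Sum>j<n. a i j * q i j ^ (p + 2) * r i)"
      by (rule J[symmetric])
    also have "\<dots> = (\<Sum>i<n. \<Sum>j<n. a i j * q i j ^ (p + 1) * r j)"
      using rD(1) by (intro sum.cong refl) (force simp: q_def field_simps)
    also have "\<dots> = (\<Sum>i<n. \<Sum>j<n. a i j * q i j ^ (p + 1) / r j)" by (rule I)
    also have "\<dots> = (\<Sum>i<n. \<Sum>j<n. a i j * q i j ^ p / r i)"
      using rD(1) by (intro sum.cong refl) (force simp: q_def field_simps)
    finally show ?thesis .
  qed
  \<comment> \<open>Two applications of the invariance give a vanishing sum of nonnegative terms.\<close>
  have "(\<Sum>i<n. \<Sum>j<n. a i j * ((q i j)\<^sup>2 - 1)\<^sup>2 / r i) =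
    (\<Sum>i<n. \<Sum>j<n. a i j * q i j ^ (2 + 2) / r i) - (\<Sum>i<n. \<Sum>j<n. a i j * q i j ^ (0 + 2) / r i)
    - ((\<Sum>i<n. \<Sum>j<n. a i j * q i j ^ (0 + 2) / r i) - (\<Sum>i<n. \<Sum>j<n. a i j * q i j ^ 0 / r i))"
    unfolding sum_subtractf[symmetric]
    by (intro sum.cong refl) (simp add: power2_eq_square power4_eq_xxxx algebra_simps diff_divide_distrib add_divide_distrib)
  also have "\<dots> = 0" unfolding shift using shift[of 0] by (simp add: power2_eq_square)
  finally have "(\<Sum>i<n. \<Sum>j<n. a i j * ((q i j)\<^sup>2 - 1)\<^sup>2 / r i) = 0" .
  moreover have nonneg: "0 \<le> a i j * ((q i j)\<^sup>2 - 1)\<^sup>2 / r i" if "i < n" for i j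
    using rD(1)[OF that] by (simp add: a_def)
  ultimately have "(\<Sum>j<n. a i j * ((q i j)\<^sup>2 - 1)\<^sup>2 / r i) = 0"
    using ij(1) by (subst (asm) sum_nonneg_eq_0_iff) (auto intro!: sum_nonneg)
  then have "a i j * ((q i j)\<^sup>2 - 1)\<^sup>2 / r i = 0"
    using ij nonneg by (subst (asm) sum_nonneg_eq_0_iff) auto
  then have "(q i j)\<^sup>2 = 1" using ij rD(1)[OF ij(1)] by (simp add: a_def)
  moreover have "q i j > 0" using rD(1) ij by (simp add: q_def)
  ultimately have "q i j = 1" by (simp add: power2_eq_1_iff)
  then show ?thesis using rD(1)[OF ij(1)] by (simp add: q_def)
qed

text \<open>Every eigenvalue of \<open>\<rho>\<close> on the range of the projection \<open>P\<close> is at most the weighted trace, since the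
  part of \<open>P\<close> in the eigenspace is a nonzero projection and has trace at least one.  The weighted trace equals the one for the
  inverse weights, which is at most \<open>d\<close> divided by the least eigenvalue on the range.  So this quotient bounds all eigenvalues on the
  range; its \<open>k\<close>-th power, taken \<open>d\<close> times, is compared with the single contribution of the least eigenvalue to the trace of
  the \<open>k\<close>-th power of \<open>1/\<rho>\<close>.\<close>

lemma weighted_trace_of_projection_bound:
  fixes P :: "complex mat" and r :: "nat \<Rightarrow> real"
  assumes P: "P \<in> carrier_mat n n" "mat_adjoint P = P" "P * P = P"
    and r: "\<And>i. i < n \<Longrightarrow> 0 < r i"
    and block: "\<And>i j. i < n \<Longrightarrow> j < n \<Longrightarrow> P $$ (i, j) \<noteq> 0 \<Longrightarrow> r i = r j"
    and tr: "(\<Sum>i<n. Re (P $$ (i, i)) * r i) = (\<Sum>i<n. Re (P $$ (i, i)) / r i)"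
    and d: "(\<Sum>i<n. Re (P $$ (i, i))) = d" "0 < d"
  shows "(\<Sum>i<n. Re (P $$ (i, i)) * r i ^ k) \<le> d ^ (k + 1) * (\<Sum>i<n. Re (P $$ (i, i)) / r i ^ k)"
proof -
  define p where "p i = Re (P $$ (i, i))" for i
  have herm: "P $$ (j, i) = cnj (P $$ (i, j))" if "i < n" "j < n" for i j
    using arg_cong[OF P(2), of "\<lambda>M. M $$ (j, i)"] P(1) that by simp
  have p_row: "p i = (\<Sum>j<n. (cmod (P $$ (i, j)))\<^sup>2)" if i: "i < n" for i
  proof -
    have "P $$ (i, i) = (\<Sum>j<n. P $$ (i, j) * P $$ (j, i))"
      using arg_cong[OF P(3), of "\<lambda>M. M $$ (i, i)"] P(1) i by (simp add: mat_mult_index)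
    also have "\<dots> = complex_of_real (\<Sum>j<n. (cmod (P $$ (i, j)))\<^sup>2)"
      unfolding of_real_sum using i herm[OF i] by (intro sum.cong refl) (simp add: complex_norm_square del: of_real_power)
    finally show ?thesis by (simp add: p_def)
  qed
  have p_nonneg: "0 \<le> p i" if "i < n" for i
    using p_row[OF that] by (simp add: sum_nonneg)
  \<comment> \<open>Cauchy-Schwarz for the positive matrix \<open>P\<close>.\<close>
  have entry: "(cmod (P $$ (i, j)))\<^sup>2 \<le> p i * p j" if i: "i < n" and j: "j < n" for i j
  proof -
    have "cmod (P $$ (i, j)) = cmod (\<Sum>l<n. P $$ (i, l) * P $$ (l, j))"
      using arg_cong[OF P(3), of "\<lambda>M. M $$ (i, j)"] P(1) i j by (simp add: mat_mult_index)
    also have "\<dots> \<le> (\<Sum>l<n. cmod (P $$ (i, l)) * cmod (P $$ (j, l)))"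
      by (rule order_trans[OF norm_sum]) (use herm[OF j] in \<open>auto intro!: sum_mono simp: norm_mult\<close>)
    finally have "(cmod (P $$ (i, j)))\<^sup>2 \<le> (\<Sum>l<n. cmod (P $$ (i, l)) * cmod (P $$ (j, l)))\<^sup>2"
      by (intro power_mono) auto
    also have "\<dots> \<le> p i * p j"
      unfolding p_row[OF i] p_row[OF j] by (rule Cauchy_Schwarz_ineq_sum)
    finally show ?thesis .
  qed
  \<comment> \<open>The trace of the part of \<open>P\<close> in the eigenspace of \<open>r i\<close>.\<close>
  define t where "t i = (\<Sum>j | j < n \<and> r j = r i. p j)" for i
  have t_ge: "1 \<le> t i" if i: "i < n" "0 < p i" for i
  proof -
    let ?B = "{j. j < n \<and> r j = r i}"
    have fin: "finite ?B" by simp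
    have "p i \<le> t i"
      unfolding t_def using i p_nonneg by (intro member_le_sum) auto
    with i have "0 < t i" by simp
    \<comment> \<open>Only the entries of \<open>P\<close> inside the eigenspace contribute, so the Cauchy-Schwarz estimate yields \<open>t i \<le> t i * t i\<close>.\<close>
    have "p j = (\<Sum>l\<in>?B. (cmod (P $$ (j, l)))\<^sup>2)" if j: "j \<in> ?B" for j
    proof -
      have "p j = (\<Sum>l<n. (cmod (P $$ (j, l)))\<^sup>2)" using j p_row by simp
      also have "\<dots> = (\<Sum>l\<in>?B. (cmod (P $$ (j, l)))\<^sup>2)"
        by (rule sum.mono_neutral_right) (use j block[of j] in auto)
      finally show ?thesis .
    qed
    then have "t i = (\<Sum>j\<in>?B. \<Sum>l\<in>?B. (cmod (P $$ (j, l)))\<^sup>2)"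
      by (simp add: t_def)
    also have "\<dots> \<le> (\<Sum>j\<in>?B. \<Sum>l\<in>?B. p j * p l)"
      by (intro sum_mono entry) auto
    also have "\<dots> = t i * t i" by (simp add: t_def sum_product)
    finally show ?thesis using \<open>0 < t i\<close> by simp
  qed
  have block_le: "f (r i) \<le> (\<Sum>j<n. p j * f (r j))"
    if i: "i < n" "0 < p i" and f: "\<And>j. j < n \<Longrightarrow> 0 \<le> f (r j)" for f i
  proof -
    have "f (r i) \<le> t i * f (r i)"
      using t_ge[OF i] f[OF i(1)] by (simp add: mult_le_cancel_right1)
    also have "\<dots> = (\<Sum>j | j < n \<and> r j = r i. p j * f (r j))"
      by (simp add: t_def sum_distrib_right)
    also have "\<dots> \<le> (\<Sum>j<n. p j * f (r j))"
      by (rule sum_mono2) (use p_nonneg f in auto)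
    finally show ?thesis .
  qed
  define supp where "supp = {i. i < n \<and> 0 < p i}"
  have fin: "finite supp" by (simp add: supp_def)
  have p0: "p i = 0" if "i < n" "i \<notin> supp" for i
    using that p_nonneg[of i] by (simp add: supp_def)
  have "supp \<noteq> {}"
  proof
    assume "supp = {}"
    then have "(\<Sum>i<n. p i) = 0" using p0 by (intro sum.neutral) auto
    then show False using d by (simp add: p_def)
  qed
  then obtain m where m: "m \<in> supp" and min: "\<And>i. i \<in> supp \<Longrightarrow> r m \<le> r i"
    using fin by (metis arg_min_if_finite(1) arg_min_least)
  have m': "m < n" "0 < p m" "0 < r m" using m r by (auto simp: supp_def)
  have inv_le: "p i / r i \<le> p i / r m" if "i < n" for i
  proof (cases "i \<in> supp")
    case True
    then show ?thesis using min[OF True] m' p_nonneg[OF that] by (intro divide_left_mono) (auto simp: r that)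
  qed (simp add: p0 that)
  have r_le: "r i \<le> d / r m" if i: "i \<in> supp" for i
  proof -
    have "r i \<le> (\<Sum>j<n. p j * r j)"
      by (rule block_le[where f="\<lambda>x. x"]) (use i r in \<open>auto simp: supp_def less_imp_le\<close>)
    also have "\<dots> = (\<Sum>j<n. p j / r j)" using tr by (simp add: p_def)
    also have "\<dots> \<le> (\<Sum>j<n. p j / r m)" using inv_le by (intro sum_mono) auto
    also have "\<dots> = d / r m" using d(1) by (simp add: p_def flip: sum_divide_distrib)
    finally show ?thesis .
  qed
  have "(\<Sum>i<n. p i * r i ^ k) \<le> (\<Sum>i<n. p i * (d / r m) ^ k)"
  proof (rule sum_mono)
    fix i assume "i \<in> {..<n}"
    then have i: "i < n" by simp
    show "p i * r i ^ k \<le> p i * (d / r m) ^ k"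
    proof (cases "i \<in> supp")
      case True
      then show ?thesis using r_le[OF True] r[OF i] p_nonneg[OF i] by (intro mult_left_mono power_mono) auto
    qed (simp add: p0 i)
  qed
  also have "\<dots> = d ^ (k + 1) * (1 / r m ^ k)"
    unfolding sum_distrib_right[symmetric] using d(1) by (simp add: p_def power_divide)
  also have "\<dots> \<le> d ^ (k + 1) * (\<Sum>i<n. p i * (1 / r i ^ k))"
    by (intro mult_left_mono block_le[where f="\<lambda>x. 1 / x ^ k"]) (use m' d r in \<open>auto simp: less_imp_le\<close>)
  finally show ?thesis by (simp add: p_def)
qed

section \<open>Decomposition into irreducible representations\<close>

lemma mult_diag_of_index:
  assumes "A \<in> carrier_mat m n" "i < m" "j < n"
  shows "(A * diag_of n d) $$ (i, j) = A $$ (i, j) * d j"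
  using assms by (simp add: mat_mult_index diag_of_def if_distrib[of "\<lambda>x. _ * x"] cong: if_cong)

lemma conjugate_diag_of_index:
  assumes V: "V \<in> carrier_mat n n" and ij: "i < n" "j < n"
  shows "(V * diag_of n d * mat_adjoint V) $$ (i, j) = (\<Sum>l<n. V $$ (i, l) * d l * cnj (V $$ (j, l)))"
proof -
  have "(V * diag_of n d * mat_adjoint V) $$ (i, j) = (\<Sum>l<n. (V * diag_of n d) $$ (i, l) * mat_adjoint V $$ (l, j))"
    using V ij by (subst mat_mult_index) auto
  then show ?thesis using V ij by (simp add: mult_diag_of_index)
qed

text \<open>The witness consists of the columns of \<open>V\<close> with index in \<open>J\<close>.\<close>

lemma isometry_onto_coordinates:
  assumes V: "V \<in> carrier_mat n n" "mat_adjoint V * V = 1\<^sub>m n" and J: "J \<subseteq> {..<n}"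
  obtains S where "S \<in> carrier_mat n (card J)" "mat_adjoint S * S = 1\<^sub>m (card J)"
    "S * mat_adjoint S = V * diag_of n (\<lambda>i. if i \<in> J then 1 else 0) * mat_adjoint V"
proof -
  have fin: "finite J" using J finite_subset by auto
  obtain e where e: "bij_betw e {0..<card J} J" using ex_bij_betw_nat_finite[OF fin] by blast
  have e': "bij_betw e {..<card J} J" using e by (simp add: atLeast0LessThan)
  have eJ: "e k \<in> J" "e k < n" if "k < card J" for k using that e' J by (auto simp: bij_betw_def)
  have e_inj: "e k = e l \<longleftrightarrow> k = l" if "k < card J" "l < card J" for k l
    using that e' by (auto simp: bij_betw_def inj_on_def)
  define S where "S = mat n (card J) (\<lambda>(i, k). V $$ (i, e k))"
  have S: "S \<in> carrier_mat n (card J)" by (simp add: S_def)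
  have "mat_adjoint S * S = 1\<^sub>m (card J)"
  proof (rule eq_matI)
    fix k l assume "k < dim_row (1\<^sub>m (card J) :: complex mat)" "l < dim_col (1\<^sub>m (card J) :: complex mat)"
    then have kl: "k < card J" "l < card J" by auto
    have "(mat_adjoint S * S) $$ (k, l) = (mat_adjoint V * V) $$ (e k, e l)"
      using kl eJ V(1) by (simp add: mat_mult_index S_def)
    then show "(mat_adjoint S * S) $$ (k, l) = 1\<^sub>m (card J) $$ (k, l)"
      using kl eJ e_inj by (simp add: V(2))
  qed (simp_all add: S_def)
  moreover have "S * mat_adjoint S = V * diag_of n (\<lambda>i. if i \<in> J then 1 else 0) * mat_adjoint V"
  proof (rule eq_matI)
    fix i j assume "i < dim_row (V * diag_of n (\<lambda>i. if i \<in> J then 1 else 0) * mat_adjoint V)"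
      "j < dim_col (V * diag_of n (\<lambda>i. if i \<in> J then 1 else 0) * mat_adjoint V)"
    then have ij: "i < n" "j < n" using V by auto
    have "(S * mat_adjoint S) $$ (i, j) = (\<Sum>k<card J. V $$ (i, e k) * cnj (V $$ (j, e k)))"
      using ij by (simp add: mat_mult_index S_def)
    also have "\<dots> = (\<Sum>l\<in>J. V $$ (i, l) * cnj (V $$ (j, l)))"
      by (rule sum.reindex_bij_betw[OF e'])
    also have "\<dots> = (\<Sum>l<n. V $$ (i, l) * (if l \<in> J then 1 else 0) * cnj (V $$ (j, l)))"
      by (rule sum.mono_neutral_cong_left) (use J in auto)
    finally show "(S * mat_adjoint S) $$ (i, j) = (V * diag_of n (\<lambda>i. if i \<in> J then 1 else 0) * mat_adjoint V) $$ (i, j)"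
      by (simp only: conjugate_diag_of_index[OF V(1) ij])
  qed (use V S in auto)
  ultimately show thesis using S that by blast
qed

lemma End_linear_combination:
  assumes X: "X \<in> End W" and Y: "Y \<in> End W" and W: "W \<in> carrier_mat n n"
  shows "a \<cdot>\<^sub>m X + b \<cdot>\<^sub>m Y \<in> End W"
proof -
  note X' = EndD(1)[OF X W] and Y' = EndD(1)[OF Y W]
  have Z: "a \<cdot>\<^sub>m X + b \<cdot>\<^sub>m Y \<in> carrier_mat n n" using X' Y' by simp
  show ?thesis
  proof (subst End_entries[OF Z W], intro allI impI)
    fix i j assume ij: "i < n" "j < n"
    have "(\<Sum>k<n. X $$ (i, k) *\<^sub>C W $$ (k, j)) = (\<Sum>k<n. X $$ (k, j) *\<^sub>C W $$ (i, k))"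
      using X End_entries[OF X' W] ij by blast
    moreover have "(\<Sum>k<n. Y $$ (i, k) *\<^sub>C W $$ (k, j)) = (\<Sum>k<n. Y $$ (k, j) *\<^sub>C W $$ (i, k))"
      using Y End_entries[OF Y' W] ij by blast
    ultimately have "a *\<^sub>C (\<Sum>k<n. X $$ (i, k) *\<^sub>C W $$ (k, j)) + b *\<^sub>C (\<Sum>k<n. Y $$ (i, k) *\<^sub>C W $$ (k, j)) =
      a *\<^sub>C (\<Sum>k<n. X $$ (k, j) *\<^sub>C W $$ (i, k)) + b *\<^sub>C (\<Sum>k<n. Y $$ (k, j) *\<^sub>C W $$ (i, k))" by simp
    then show "(\<Sum>k<n. (a \<cdot>\<^sub>m X + b \<cdot>\<^sub>m Y) $$ (i, k) *\<^sub>C W $$ (k, j)) =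
        (\<Sum>k<n. (a \<cdot>\<^sub>m X + b \<cdot>\<^sub>m Y) $$ (k, j) *\<^sub>C W $$ (i, k))"
      using ij X' Y' by (simp add: cspace.scale_sum_right scaleC_add_left scaleC_scaleC sum.distrib)
  qed
qed

lemma scalar_in_End:
  assumes W: "W \<in> carrier_mat n n"
  shows "c \<cdot>\<^sub>m 1\<^sub>m n \<in> End W"
proof (subst End_entries[OF _ W], safe)
  fix i j assume ij: "i < n" "j < n"
  have "(\<Sum>k<n. (c \<cdot>\<^sub>m 1\<^sub>m n) $$ (i, k) *\<^sub>C W $$ (k, j)) = (\<Sum>k<n. if k = i then c *\<^sub>C W $$ (k, j) else 0)"
    using ij by (intro sum.cong) auto
  also have "\<dots> = (\<Sum>k<n. if k = j then c *\<^sub>C W $$ (i, k) else 0)"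
    using ij by simp
  also have "\<dots> = (\<Sum>k<n. (c \<cdot>\<^sub>m 1\<^sub>m n) $$ (k, j) *\<^sub>C W $$ (i, k))"
    using ij by (intro sum.cong) auto
  finally show "(\<Sum>k<n. (c \<cdot>\<^sub>m 1\<^sub>m n) $$ (i, k) *\<^sub>C W $$ (k, j)) = (\<Sum>k<n. (c \<cdot>\<^sub>m 1\<^sub>m n) $$ (k, j) *\<^sub>C W $$ (i, k))" .
qed simp

lemma one_End: "W \<in> carrier_mat n n \<Longrightarrow> 1\<^sub>m n \<in> End W"
  by (rule EndI) auto

text \<open>An endomorphism of a subrepresentation, extended by zero to the orthogonal complement.\<close>

lemma End_of_compress:
  assumes T: "T \<in> carrier_mat n d" and W: "W \<in> carrier_mat n n"
    and iso: "mat_adjoint T * T = 1\<^sub>m d" and P: "T * mat_adjoint T \<in> End W"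
    and Y: "Y \<in> End (compress T W)"
  shows "T * Y * mat_adjoint T \<in> End W"
proof (rule EndI[OF _ W])
  note int = compress_intertwines[OF T W iso P]
  have cC: "compress T W \<in> carrier_mat d d" using T W by (rule compress_closed)
  note Y' = EndD[OF Y cC]
  show "T * Y * mat_adjoint T \<in> carrier_mat n n" using T Y' by auto
  have "amp (T * Y * mat_adjoint T) * W = amp T * (amp Y * (amp (mat_adjoint T) * W))"
    using T W Y'(1) by (simp add: amp_mult mat_assoc)
  also have "\<dots> = amp T * (amp Y * compress T W) * amp (mat_adjoint T)"
    unfolding int(2)[symmetric] using T W Y'(1) cC by (simp add: mat_assoc)
  also have "\<dots> = (amp T * compress T W) * amp Y * amp (mat_adjoint T)"
    unfolding Y'(2) using T W Y'(1) cC by (simp add: mat_assoc)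
  also have "\<dots> = W * amp (T * Y * mat_adjoint T)"
    unfolding int(1) using T W Y'(1) cC by (simp add: amp_mult mat_assoc)
  finally show "amp (T * Y * mat_adjoint T) * W = W * amp (T * Y * mat_adjoint T)" .
qed

lemma compress_mult:
  assumes V: "V \<in> carrier_mat n n" "V * mat_adjoint V = 1\<^sub>m n"
    and A: "A \<in> carrier_mat n n" "B \<in> carrier_mat n n"
  shows "compress V (A * B) = compress V A * (compress V B :: 'a::unital_cstar_algebra mat)"
proof -
  have one: "amp V * amp (mat_adjoint V) = (1\<^sub>m n :: 'a mat)"
    using V by (simp flip: amp_mult)
  have "compress V A * compress V B = amp (mat_adjoint V) * (A * ((amp V * amp (mat_adjoint V)) * (B * amp V)))"
    unfolding compress_def using V(1) A by (simp add: mat_assoc)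
  also have "\<dots> = compress V (A * B)"
    unfolding one compress_def using V(1) A by (simp add: mat_assoc)
  finally show ?thesis ..
qed

lemma compress_amp:
  "dim_row T = dim_row X \<Longrightarrow> dim_col X = dim_row T \<Longrightarrow> compress T (amp X) = amp (mat_adjoint T * X * T)"
  by (simp add: compress_def amp_mult)

lemma End_compress_unitary:
  assumes V: "V \<in> carrier_mat n n" "V * mat_adjoint V = 1\<^sub>m n" and W: "W \<in> carrier_mat n n"
    and X: "X \<in> End W"
  shows "mat_adjoint V * X * V \<in> End (compress V W)"
proof (rule EndI)
  note X' = EndD[OF X W]
  show "mat_adjoint V * X * V \<in> carrier_mat n n" using V X' by auto
  show "compress V W \<in> carrier_mat n n" using V W by (intro compress_closed)
  have "amp (mat_adjoint V * X * V) * compress V W = compress V (amp X * W)"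
    using V X'(1) W by (simp add: compress_amp[symmetric] compress_mult)
  also have "\<dots> = compress V W * amp (mat_adjoint V * X * V)"
    unfolding X'(2) using V X'(1) W by (simp add: compress_amp[symmetric] compress_mult)
  finally show "amp (mat_adjoint V * X * V) * compress V W = compress V W * amp (mat_adjoint V * X * V)" .
qed

text \<open>The real and the imaginary part of a non-scalar endomorphism are endomorphisms, and they cannot both be scalar.\<close>

lemma reducible_has_hermitian:
  assumes W: "W \<in> carrier_mat n n" "star_mat W * W = 1\<^sub>m n" "W * star_mat W = 1\<^sub>m n"
    and red: "\<not> irreducible_rep W"
  obtains H where "H \<in> End W" "mat_adjoint H = H" "\<nexists>c. H = c \<cdot>\<^sub>m 1\<^sub>m n"
proof -
  obtain X where X: "X \<in> End W" and nX: "\<And>c. X \<noteq> c \<cdot>\<^sub>m 1\<^sub>m n"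
    using red W(1) scalar_in_End[OF W(1)] by (auto simp: irreducible_rep_def)
  note X' = EndD(1)[OF X W(1)]
  note aX = End_adjoint[OF X W]
  define H1 where "H1 = 1 \<cdot>\<^sub>m X + 1 \<cdot>\<^sub>m mat_adjoint X"
  define H2 where "H2 = \<i> \<cdot>\<^sub>m X + (-\<i>) \<cdot>\<^sub>m mat_adjoint X"
  have E: "H1 \<in> End W" "H2 \<in> End W"
    unfolding H1_def H2_def by (rule End_linear_combination[OF X aX W(1)])+
  have h: "mat_adjoint H1 = H1" "mat_adjoint H2 = H2"
    by (rule eq_matI; use X' in \<open>simp add: H1_def H2_def\<close>)+
  show thesis
  proof (cases "\<exists>c. H1 = c \<cdot>\<^sub>m 1\<^sub>m n")
    case False
    with E h that show ?thesis by blast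
  next
    case True
    then obtain c1 where c1: "H1 = c1 \<cdot>\<^sub>m 1\<^sub>m n" by blast
    have "\<nexists>c. H2 = c \<cdot>\<^sub>m 1\<^sub>m n"
    proof
      assume "\<exists>c. H2 = c \<cdot>\<^sub>m 1\<^sub>m n"
      then obtain c2 where c2: "H2 = c2 \<cdot>\<^sub>m 1\<^sub>m n" by blast
      have "X = ((c1 - \<i> * c2) / 2) \<cdot>\<^sub>m 1\<^sub>m n"
      proof (rule eq_matI)
        fix i j assume "i < dim_row (((c1 - \<i> * c2) / 2) \<cdot>\<^sub>m 1\<^sub>m n)" "j < dim_col (((c1 - \<i> * c2) / 2) \<cdot>\<^sub>m 1\<^sub>m n)"
        then have ij: "i < n" "j < n" by auto
        have "X $$ (i, j) = (H1 $$ (i, j) - \<i> * H2 $$ (i, j)) / 2"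
          using ij X' by (simp add: H1_def H2_def algebra_simps)
        also have "\<dots> = (((c1 - \<i> * c2) / 2) \<cdot>\<^sub>m 1\<^sub>m n) $$ (i, j)"
          using ij by (simp add: c1 c2)
        finally show "X $$ (i, j) = (((c1 - \<i> * c2) / 2) \<cdot>\<^sub>m 1\<^sub>m n) $$ (i, j)" .
      qed (use X' in auto)
      with nX show False by blast
    qed
    with E h that show ?thesis by blast
  qed
qed

text \<open>In an eigenbasis of a non-scalar Hermitian endomorphism, the entries of \<open>W\<close> between different eigenvalues vanish.  The
  eigenspace of one eigenvalue and its orthogonal complement are therefore proper invariant subspaces.\<close>

theorem reducible_splits:
  assumes W: "W \<in> carrier_mat n n" "star_mat W * W = 1\<^sub>m n" "W * star_mat W = 1\<^sub>m n"
    and red: "\<not> irreducible_rep W"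
  obtains S1 d1 S2 d2 where
    "S1 \<in> carrier_mat n d1" "mat_adjoint S1 * S1 = 1\<^sub>m d1" "S1 * mat_adjoint S1 \<in> End W" "0 < d1"
    "S2 \<in> carrier_mat n d2" "mat_adjoint S2 * S2 = 1\<^sub>m d2" "S2 * mat_adjoint S2 \<in> End W" "0 < d2"
    "d1 + d2 = n" "S1 * mat_adjoint S1 + S2 * mat_adjoint S2 = 1\<^sub>m n"
proof -
  obtain H where H: "H \<in> End W" "mat_adjoint H = H" and nH: "\<nexists>c. H = c \<cdot>\<^sub>m 1\<^sub>m n"
    by (rule reducible_has_hermitian[OF W red])
  note H' = EndD(1)[OF H(1) W(1)]
  obtain V d where V: "V \<in> carrier_mat n n" "mat_adjoint V * V = 1\<^sub>m n" "V * mat_adjoint V = 1\<^sub>m n"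
    and D: "mat_adjoint V * H * V = diag_of n (\<lambda>i. complex_of_real (d i))"
    using hermitian_unitary_diagonalization[OF H' H(2)] by blast
  have aV: "mat_adjoint V \<in> carrier_mat n n" using V by simp
  obtain k where k: "k < n" "d k \<noteq> d 0"
  proof (rule ccontr)
    assume "\<not> thesis"
    then have all: "d k = d 0" if "k < n" for k using that \<open>\<And>k. k < n \<Longrightarrow> d k \<noteq> d 0 \<Longrightarrow> thesis\<close> by blast
    have diag: "diag_of n (\<lambda>i. complex_of_real (d i)) = complex_of_real (d 0) \<cdot>\<^sub>m 1\<^sub>m n"
      by (rule eq_matI) (auto simp: diag_of_def intro: all)
    have "H = (V * mat_adjoint V) * H * (V * mat_adjoint V)" using V H' by simp
    also have "\<dots> = V * (mat_adjoint V * H * V) * mat_adjoint V"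
      using V(1) H' by (simp add: mat_assoc)
    also have "\<dots> = complex_of_real (d 0) \<cdot>\<^sub>m (V * mat_adjoint V)"
      unfolding D diag using V(1) aV
    by (simp add: mult_smult_distrib[of _ n n _ n] mult_smult_assoc_mat[of _ n n _ n])
    finally show False using nH unfolding V(3) by blast
  qed
  define J where "J = {i. i < n \<and> d i = d 0}"
  define K where "K = {i. i < n \<and> d i \<noteq> d 0}"
  have JK: "J \<subseteq> {..<n}" "K \<subseteq> {..<n}" "J \<union> K = {..<n}" "J \<inter> K = {}" "finite J" "finite K"
    by (auto simp: J_def K_def)
  have ne: "0 \<in> J" "k \<in> K" using k by (auto simp: J_def K_def)
  let ?B = "compress V W"
  have B: "?B \<in> carrier_mat n n" using V W by (intro compress_closed)
  have block: "?B $$ (i, j) = 0" if ij: "i < n" "j < n" "d i \<noteq> d j" for i j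
  proof -
    have "diag_of n (\<lambda>i. complex_of_real (d i)) \<in> End ?B"
      using End_compress_unitary[OF V(1,3) W(1) H(1)] D by simp
    then have "(\<Sum>l<n. diag_of n (\<lambda>i. complex_of_real (d i)) $$ (i, l) *\<^sub>C ?B $$ (l, j)) =
       (\<Sum>l<n. diag_of n (\<lambda>i. complex_of_real (d i)) $$ (l, j) *\<^sub>C ?B $$ (i, l))"
      using End_entries[OF diag_of_carrier B] ij by blast
    moreover have "(\<Sum>l<n. diag_of n (\<lambda>i. complex_of_real (d i)) $$ (i, l) *\<^sub>C ?B $$ (l, j)) =
        (\<Sum>l<n. if l = i then complex_of_real (d i) *\<^sub>C ?B $$ (l, j) else 0)"
      using ij by (intro sum.cong) (auto simp: diag_of_def)
    moreover have "(\<Sum>l<n. diag_of n (\<lambda>i. complex_of_real (d i)) $$ (l, j) *\<^sub>C ?B $$ (i, l)) =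
        (\<Sum>l<n. if l = j then complex_of_real (d j) *\<^sub>C ?B $$ (i, l) else 0)"
      using ij by (intro sum.cong) (auto simp: diag_of_def)
    ultimately have "complex_of_real (d i) *\<^sub>C ?B $$ (i, j) = complex_of_real (d j) *\<^sub>C ?B $$ (i, j)"
      using ij by simp
    then show ?thesis using ij(3) by simp
  qed
  have ind: "diag_of n (\<lambda>i. if i \<in> L then 1 else 0) \<in> End ?B" if L: "L = J \<or> L = K" for L
  proof (subst End_entries[OF diag_of_carrier B], intro allI impI)
    fix i j assume ij: "i < n" "j < n"
    let ?D = "diag_of n (\<lambda>i. if i \<in> L then 1 else 0)"
    have "(\<Sum>l<n. ?D $$ (i, l) *\<^sub>C ?B $$ (l, j)) = (\<Sum>l<n. if l = i then (if i \<in> L then ?B $$ (l, j) else 0) else 0)"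
      using ij by (intro sum.cong) (auto simp: diag_of_def)
    also have "\<dots> = (if i \<in> L then ?B $$ (i, j) else 0)" using ij by simp
    also have "\<dots> = (if j \<in> L then ?B $$ (i, j) else 0)"
      using block[of i j] ij L by (auto simp: J_def K_def)
    also have "\<dots> = (\<Sum>l<n. if l = j then (if j \<in> L then ?B $$ (i, l) else 0) else 0)" using ij by simp
    also have "\<dots> = (\<Sum>l<n. ?D $$ (l, j) *\<^sub>C ?B $$ (i, l))"
      using ij by (intro sum.cong) (auto simp: diag_of_def)
    finally show "(\<Sum>l<n. ?D $$ (i, l) *\<^sub>C ?B $$ (l, j)) = (\<Sum>l<n. ?D $$ (l, j) *\<^sub>C ?B $$ (i, l))" .
  qed
  have VV: "V * mat_adjoint V \<in> End W" using one_End[OF W(1)] V(3) by simp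
  obtain S1 where S1: "S1 \<in> carrier_mat n (card J)" "mat_adjoint S1 * S1 = 1\<^sub>m (card J)"
    "S1 * mat_adjoint S1 = V * diag_of n (\<lambda>i. if i \<in> J then 1 else 0) * mat_adjoint V"
    using isometry_onto_coordinates[OF V(1,2) JK(1)] by blast
  obtain S2 where S2: "S2 \<in> carrier_mat n (card K)" "mat_adjoint S2 * S2 = 1\<^sub>m (card K)"
    "S2 * mat_adjoint S2 = V * diag_of n (\<lambda>i. if i \<in> K then 1 else 0) * mat_adjoint V"
    using isometry_onto_coordinates[OF V(1,2) JK(2)] by blast
  have "S1 * mat_adjoint S1 \<in> End W" "S2 * mat_adjoint S2 \<in> End W"
    unfolding S1(3) S2(3) by (rule End_of_compress[OF V(1) W(1) V(2) VV ind]; simp)+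
  moreover have "0 < card J" "0 < card K" using ne JK by (auto simp: card_gt_0_iff)
  moreover have "card J + card K = n"
    using card_Un_disjoint[OF JK(5,6,4)] JK(3) by simp
  moreover have "S1 * mat_adjoint S1 + S2 * mat_adjoint S2 = 1\<^sub>m n"
  proof (rule eq_matI)
    fix i j assume "i < dim_row (1\<^sub>m n :: complex mat)" "j < dim_col (1\<^sub>m n :: complex mat)"
    then have ij: "i < n" "j < n" by auto
    have "(S1 * mat_adjoint S1 + S2 * mat_adjoint S2) $$ (i, j) =
        (S1 * mat_adjoint S1) $$ (i, j) + (S2 * mat_adjoint S2) $$ (i, j)"
      using ij S1(1) S2(1) by simp
    also have "\<dots> = (\<Sum>l<n. V $$ (i, l) * (if l \<in> J then 1 else 0) * cnj (V $$ (j, l)) +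
        V $$ (i, l) * (if l \<in> K then 1 else 0) * cnj (V $$ (j, l)))"
      unfolding S1(3) S2(3) by (simp only: conjugate_diag_of_index[OF V(1) ij] sum.distrib)
    also have "\<dots> = (\<Sum>l<n. V $$ (i, l) * cnj (V $$ (j, l)))"
      using JK by (intro sum.cong) auto
    also have "\<dots> = (V * mat_adjoint V) $$ (i, j)"
      using V(1) ij by (simp add: mat_mult_index)
    finally show "(S1 * mat_adjoint S1 + S2 * mat_adjoint S2) $$ (i, j) = 1\<^sub>m n $$ (i, j)" by (simp add: V(3))
  qed (use S1(1) S2(1) in auto)
  ultimately show thesis using that[OF S1(1,2) _ _ S2(1,2)] by blast
qed

lemma trace_of_isometry:
  assumes T: "T \<in> carrier_mat n d" and iso: "mat_adjoint T * T = 1\<^sub>m d"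
  shows "(\<Sum>i<n. Re ((T * mat_adjoint T) $$ (i, i))) = real d"
proof -
  have "(\<Sum>i<n. (T * mat_adjoint T) $$ (i, i)) = (\<Sum>i<n. \<Sum>j<d. T $$ (i, j) * cnj (T $$ (i, j)))"
    using T by (intro sum.cong) (simp_all add: mat_mult_index)
  also have "\<dots> = (\<Sum>j<d. (mat_adjoint T * T) $$ (j, j))"
    using T by (subst sum.swap) (simp add: mat_mult_index mult.commute)
  also have "\<dots> = of_nat d" by (simp add: iso)
  finally have "(\<Sum>i<n. (T * mat_adjoint T) $$ (i, i)) = of_nat d" .
  from arg_cong[OF this, of Re] show ?thesis by simp
qed

text \<open>The second estimate is the first one for the weights \<open>1 / r i\<close>, which satisfy the same hypotheses.\<close>

lemma weighted_trace_of_isometry_bound: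
  assumes r: "spherical_weights W r"
    and W: "W \<in> carrier_mat n n" "star_mat W * W = 1\<^sub>m n" "W * star_mat W = 1\<^sub>m n"
    and T: "T \<in> carrier_mat n d" "mat_adjoint T * T = 1\<^sub>m d" and P: "T * mat_adjoint T \<in> End W"
    and d: "0 < d"
  shows "(\<Sum>i<n. Re ((T * mat_adjoint T) $$ (i, i)) * r i ^ k) \<le>
      real d ^ (k + 1) * (\<Sum>i<n. Re ((T * mat_adjoint T) $$ (i, i)) / r i ^ k)"
    "(\<Sum>i<n. Re ((T * mat_adjoint T) $$ (i, i)) / r i ^ k) \<le>
      real d ^ (k + 1) * (\<Sum>i<n. Re ((T * mat_adjoint T) $$ (i, i)) * r i ^ k)"
proof -
  let ?P = "T * mat_adjoint T"
  note rD = spherical_weightsD[OF r W(1)]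
  have cP: "?P \<in> carrier_mat n n" using T by simp
  have aP: "mat_adjoint ?P = ?P" using T by (simp add: mat_adjoint_mult[of _ n d _ n])
  have "?P * ?P = T * (mat_adjoint T * T) * mat_adjoint T" using T(1) by (simp add: mat_assoc)
  then have PP: "?P * ?P = ?P" using T by simp
  have block: "r i = r j" if "i < n" "j < n" "?P $$ (i, j) \<noteq> 0" for i j
    using End_commutes_with_weights[OF r W P that] .
  have tr: "(\<Sum>i<n. Re (?P $$ (i, i)) * r i) = (\<Sum>i<n. Re (?P $$ (i, i)) / r i)"
    using arg_cong[OF rD(4)[OF P], of Re] by simp
  have dim: "(\<Sum>i<n. Re (?P $$ (i, i))) = real d" "0 < real d"
    using trace_of_isometry[OF T] d by auto
  show "(\<Sum>i<n. Re (?P $$ (i, i)) * r i ^ k) \<le> real d ^ (k + 1) * (\<Sum>i<n. Re (?P $$ (i, i)) / r i ^ k)"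
    by (rule weighted_trace_of_projection_bound[OF cP aP PP rD(1) block tr dim])
  have "(\<Sum>i<n. Re (?P $$ (i, i)) * (1 / r i) ^ k) \<le> real d ^ (k + 1) * (\<Sum>i<n. Re (?P $$ (i, i)) / (1 / r i) ^ k)"
    by (rule weighted_trace_of_projection_bound[OF cP aP PP _ _ _ dim])
      (use rD(1) block tr in \<open>auto simp: \<close>)
  then show "(\<Sum>i<n. Re (?P $$ (i, i)) / r i ^ k) \<le> real d ^ (k + 1) * (\<Sum>i<n. Re (?P $$ (i, i)) * r i ^ k)"
    by (simp add: power_divide)
qed

text \<open>Both estimates are linear in the projection onto the range of \<open>T\<close> and have a common constant, so they pass to orthogonal
  sums.  For irreducible summands \<open>B\<close> dominates the power of the dimension in \<open>weighted_trace_of_isometry_bound\<close>.\<close>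

theorem weighted_trace_bound:
  fixes W :: "'a::unital_cstar_algebra mat"
  assumes cqg: "compact_quantum_group tens tens_l tens_r \<Delta>"
    and rep: "unitary_representation tens \<Delta> W" and n: "dim_row W = n"
    and r: "spherical_weights W r"
    and B: "\<And>T d. T \<in> carrier_mat n d \<Longrightarrow> 0 < d \<Longrightarrow> mat_adjoint T * T = 1\<^sub>m d \<Longrightarrow>
        T * mat_adjoint T \<in> End W \<Longrightarrow> irreducible_rep (compress T W) \<Longrightarrow> real d ^ (k + 1) \<le> B"
    and T: "T \<in> carrier_mat n d" "0 < d" "mat_adjoint T * T = 1\<^sub>m d" "T * mat_adjoint T \<in> End W"
  shows "(\<Sum>i<n. Re ((T * mat_adjoint T) $$ (i, i)) * r i ^ k) \<le>
      B * (\<Sum>i<n. Re ((T * mat_adjoint T) $$ (i, i)) / r i ^ k) \<and>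
    (\<Sum>i<n. Re ((T * mat_adjoint T) $$ (i, i)) / r i ^ k) \<le>
      B * (\<Sum>i<n. Re ((T * mat_adjoint T) $$ (i, i)) * r i ^ k)"
  using T
proof (induction d arbitrary: T rule: less_induct)
  case (less d T)
  note T = less.prems
  note W = unitary_representationD[OF rep, unfolded n]
  note rD = spherical_weightsD[OF r W(1)]
  have diag: "0 \<le> Re ((T * mat_adjoint T) $$ (i, i))" if "i < n" for i
  proof -
    have "(T * mat_adjoint T) $$ (i, i) = (\<Sum>j<d. T $$ (i, j) * cnj (T $$ (i, j)))"
      using T(1) that by (simp add: mat_mult_index)
    then show ?thesis by (simp add: sum_nonneg)
  qed
  show ?case
  proof (cases "irreducible_rep (compress T W)")
    case True
    note le = B[OF T True]
    note bound = weighted_trace_of_isometry_bound[OF r W(1,3,4) T(1,3,4,2), of k]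
    have "0 \<le> (\<Sum>i<n. Re ((T * mat_adjoint T) $$ (i, i)) / r i ^ k)"
      "0 \<le> (\<Sum>i<n. Re ((T * mat_adjoint T) $$ (i, i)) * r i ^ k)"
      using diag rD(1) by (auto intro!: sum_nonneg simp: less_imp_le)
    then show ?thesis
      using bound mult_right_mono[OF le] by (meson order_trans)
  next
    case False
    let ?A = "compress T W"
    have A: "unitary_representation tens \<Delta> ?A"
      by (rule compress_unitary_representation[OF cqg rep n T(1,2,3,4)])
    have cA: "?A \<in> carrier_mat d d" using T(1) W(1) by (rule compress_closed)
    then have dA: "dim_row ?A = d" by simp
    note A' = unitary_representationD[OF A, unfolded dA]
    obtain S1 d1 S2 d2 where
      S1: "S1 \<in> carrier_mat d d1" "mat_adjoint S1 * S1 = 1\<^sub>m d1" "S1 * mat_adjoint S1 \<in> End ?A" "0 < d1" and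
      S2: "S2 \<in> carrier_mat d d2" "mat_adjoint S2 * S2 = 1\<^sub>m d2" "S2 * mat_adjoint S2 \<in> End ?A" "0 < d2" and
      sum: "d1 + d2 = d" "S1 * mat_adjoint S1 + S2 * mat_adjoint S2 = 1\<^sub>m d"
      by (rule reducible_splits[OF A'(1,3,4) False])
    have comp: "T * S \<in> carrier_mat n e" "mat_adjoint (T * S) * (T * S) = 1\<^sub>m e"
      "T * S * mat_adjoint (T * S) = T * (S * mat_adjoint S) * mat_adjoint T"
      "T * S * mat_adjoint (T * S) \<in> End W"
      if S: "S \<in> carrier_mat d e" "mat_adjoint S * S = 1\<^sub>m e" "S * mat_adjoint S \<in> End ?A" for S e
    proof -
      show "T * S \<in> carrier_mat n e" using T S by simp
      have adj: "mat_adjoint (T * S) = mat_adjoint S * mat_adjoint T" by (rule mat_adjoint_mult[OF T(1) S(1)])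
      have "mat_adjoint (T * S) * (T * S) = mat_adjoint S * ((mat_adjoint T * T) * S)"
        unfolding adj using T(1) S(1) by (simp add: mat_assoc)
      then show "mat_adjoint (T * S) * (T * S) = 1\<^sub>m e" using T(3) S by simp
      show *: "T * S * mat_adjoint (T * S) = T * (S * mat_adjoint S) * mat_adjoint T"
        unfolding adj using T(1) S(1) by (simp add: mat_assoc)
      show "T * S * mat_adjoint (T * S) \<in> End W"
        unfolding * by (rule End_of_compress[OF T(1) W(1) T(3,4) S(3)])
    qed
    note C1 = comp[OF S1(1,2,3)] and C2 = comp[OF S2(1,2,3)]
    have "T * mat_adjoint T = T * (S1 * mat_adjoint S1 + S2 * mat_adjoint S2) * mat_adjoint T"
      unfolding sum(2) using T(1) by simp
    also have "\<dots> = T * S1 * mat_adjoint (T * S1) + T * S2 * mat_adjoint (T * S2)"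
      unfolding C1(3) C2(3) using T(1) S1(1) S2(1)
      by (simp add: mult_add_distrib_mat[of _ n d _ d] add_mult_distrib_mat[of _ n d _ _ n])
    finally have split: "Re ((T * mat_adjoint T) $$ (i, i)) =
        Re ((T * S1 * mat_adjoint (T * S1)) $$ (i, i)) + Re ((T * S2 * mat_adjoint (T * S2)) $$ (i, i))"
      if "i < n" for i
      using that T(1) S1(1) S2(1) by simp
    have "d1 < d" "d2 < d" using sum S1(4) S2(4) by auto
    note IH = less.IH[OF \<open>d1 < d\<close> C1(1) S1(4) C1(2,4)] less.IH[OF \<open>d2 < d\<close> C2(1) S2(4) C2(2,4)]
    have "(\<Sum>i<n. Re ((T * mat_adjoint T) $$ (i, i)) * f i) =
        (\<Sum>i<n. Re ((T * S1 * mat_adjoint (T * S1)) $$ (i, i)) * f i) +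
        (\<Sum>i<n. Re ((T * S2 * mat_adjoint (T * S2)) $$ (i, i)) * f i)" for f :: "nat \<Rightarrow> real"
      by (simp add: split distrib_right sum.distrib)
    from this[of "\<lambda>i. r i ^ k"] this[of "\<lambda>i. 1 / r i ^ k"] show ?thesis
      using IH by (simp add: distrib_left)
  qed
qed

section \<open>Growth and power sums\<close>

text \<open>With the offset existentially quantified, the induction over the list need not track the position of \<open>A\<close>.\<close>

lemma diag_block_mat_columns:
  assumes "\<And>A. A \<in> set As \<Longrightarrow> square_mat A" "A \<in> set As"
  shows "\<exists>off. off + dim_row A \<le> dim_row (diag_block_mat As) \<and>
    (\<forall>i<dim_row (diag_block_mat As). \<forall>j<dim_row A.
       diag_block_mat As $$ (i, off + j) = (if off \<le> i \<and> i < off + dim_row A then A $$ (i - off, j) else 0))"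
  using assms
proof (induction As)
  case (Cons B As)
  let ?D = "diag_block_mat As"
  have sq: "dim_col B = dim_row B" "dim_col ?D = dim_row ?D"
    using Cons.prems(1) diag_block_mat_square[of As] by (auto simp: square_mat.simps)
  show ?case
  proof (cases "A = B")
    case True
    then show ?thesis using sq by (intro exI[of _ 0]) (auto simp: Let_def)
  next
    case False
    then have "A \<in> set As" using Cons.prems(2) by simp
    then obtain off where off: "off + dim_row A \<le> dim_row ?D"
      "\<And>i j. i < dim_row ?D \<Longrightarrow> j < dim_row A \<Longrightarrow>
       ?D $$ (i, off + j) = (if off \<le> i \<and> i < off + dim_row A then A $$ (i - off, j) else 0)"
      using Cons.IH Cons.prems(1) by auto
    show ?thesis
    proof (intro exI[of _ "dim_row B + off"] conjI allI impI)
      fix i j assume i: "i < dim_row (diag_block_mat (B # As))" and j: "j < dim_row A"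
      show "diag_block_mat (B # As) $$ (i, dim_row B + off + j) =
        (if dim_row B + off \<le> i \<and> i < dim_row B + off + dim_row A then A $$ (i - (dim_row B + off), j) else 0)"
        using i j off sq by (auto simp: Let_def add.assoc)
    qed (use off in \<open>auto simp: Let_def\<close>)
  qed
qed simp

text \<open>Compose with the inclusion \<open>J\<close> of the block.\<close>

lemma isometric_intertwiner_into_diag_block:
  fixes A \<alpha> :: "'a::unital_cstar_algebra mat"
  assumes sq: "\<And>A. A \<in> set As \<Longrightarrow> square_mat A" and A: "A \<in> set As"
    and \<alpha>: "\<alpha> \<in> carrier_mat d d"
    and T: "T \<in> Mor \<alpha> A" "mat_adjoint T * T = 1\<^sub>m d"
  shows "\<exists>T'\<in>Mor \<alpha> (diag_block_mat As). mat_adjoint T' * T' = 1\<^sub>m d"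
proof -
  let ?D = "diag_block_mat As"
  define n N where "n = dim_row A" and "N = dim_row ?D"
  have cA: "A \<in> carrier_mat n n" using sq[OF A] by (auto simp: n_def square_mat.simps)
  have cD: "?D \<in> carrier_mat N N" using diag_block_mat_square[of As] sq by (auto simp: N_def square_mat.simps)
  have cT: "T \<in> carrier_mat n d" and AT: "amp T * \<alpha> = A * amp T"
    using T \<alpha> by (auto simp: Mor_def n_def)
  obtain off where off: "off + n \<le> N"
    "\<And>i j. i < N \<Longrightarrow> j < n \<Longrightarrow> ?D $$ (i, off + j) = (if off \<le> i \<and> i < off + n then A $$ (i - off, j) else 0)"
    using diag_block_mat_columns[OF sq A] unfolding n_def N_def by auto
  define J where "J = mat N n (\<lambda>(i, j). if i = off + j then 1 else (0 :: complex))"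
  have J: "J \<in> carrier_mat N n" by (simp add: J_def)
  have JJ: "mat_adjoint J * J = 1\<^sub>m n"
  proof (rule eq_matI)
    fix i j assume "i < dim_row (1\<^sub>m n :: complex mat)" "j < dim_col (1\<^sub>m n :: complex mat)"
    then have ij: "i < n" "j < n" by auto
    have "(mat_adjoint J * J) $$ (i, j) = (\<Sum>k<N. cnj (J $$ (k, i)) * J $$ (k, j))"
      using ij J by (simp add: mat_mult_index)
    also have "\<dots> = (\<Sum>k<N. if k = off + i then if i = j then 1 else 0 else 0)"
      using ij by (intro sum.cong) (auto simp: J_def)
    finally show "(mat_adjoint J * J) $$ (i, j) = 1\<^sub>m n $$ (i, j)" using ij off(1) by simp
  qed (use J in auto)
  have AJ: "amp J * A = ?D * amp J"
  proof (rule eq_matI)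
    fix i j assume "i < dim_row (?D * amp J)" "j < dim_col (?D * amp J)"
    then have i: "i < N" and j: "j < n" using J cD by auto
    have "(?D * amp J) $$ (i, j) = (\<Sum>k<N. ?D $$ (i, k) * (J $$ (k, j) *\<^sub>C 1))"
      using i j J cD by (simp add: mat_mult_index)
    also have "\<dots> = (\<Sum>k<N. if k = off + j then ?D $$ (i, k) else 0)"
      using j by (intro sum.cong) (auto simp: J_def)
    also have "\<dots> = (if off \<le> i \<and> i < off + n then A $$ (i - off, j) else 0)"
      using off i j by simp
    also have "\<dots> = (\<Sum>k<n. if k = i - off then if off \<le> i then A $$ (k, j) else 0 else 0)"
      by auto
    also have "\<dots> = (\<Sum>k<n. (J $$ (i, k) *\<^sub>C 1) * A $$ (k, j))"
      using i by (intro sum.cong) (auto simp: J_def)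
    also have "\<dots> = (amp J * A) $$ (i, j)"
      using i j J cA by (simp add: mat_mult_index)
    finally show "(amp J * A) $$ (i, j) = (?D * amp J) $$ (i, j)" by simp
  qed (use J cA cD in auto)
  have "amp (J * T) * \<alpha> = amp J * (A * amp T)" using J cT cA \<alpha> by (simp add: amp_mult mat_assoc AT)
  also have "\<dots> = (amp J * A) * amp T" using J cT cA by (simp add: mat_assoc)
  also have "\<dots> = ?D * amp (J * T)" unfolding AJ using J cT cD by (simp add: amp_mult mat_assoc)
  finally have "J * T \<in> Mor \<alpha> ?D" using J cT \<alpha> cD by (auto simp: Mor_def)
  moreover have "mat_adjoint (J * T) * (J * T) = 1\<^sub>m d"
  proof -
    have "mat_adjoint (J * T) * (J * T) = mat_adjoint T * ((mat_adjoint J * J) * T)"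
      unfolding mat_adjoint_mult[OF J cT] using J cT by (simp add: mat_assoc)
    then show ?thesis using JJ cT T(2) by simp
  qed
  ultimately show ?thesis by blast
qed

lemma equivalent_rep_dim:
  assumes "equivalent_rep \<alpha> \<beta>"
  shows "dim_row \<alpha> = dim_row \<beta>"
  using assms by (auto simp: equivalent_rep_def Mor_def invertible_mat_def square_mat.simps)

lemma equivalent_rep_refl:
  assumes "\<alpha> \<in> carrier_mat d d"
  shows "equivalent_rep \<alpha> \<alpha>"
proof -
  have "1\<^sub>m d \<in> Mor \<alpha> \<alpha>" using one_End[OF assms] .
  moreover have "invertible_mat (1\<^sub>m d :: complex mat)"
    by (auto simp: invertible_mat_def inverts_mat_def square_mat.simps intro!: exI[of _ "1\<^sub>m d"])
  ultimately show ?thesis by (auto simp: equivalent_rep_def)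
qed

lemma tensor_power_unitary_representation:
  assumes cqg: "compact_quantum_group tens tens_l tens_r \<Delta>" and U: "unitary_representation tens \<Delta> U"
  shows "unitary_representation tens \<Delta> (tensor_power U n)"
  by (induction n) (simp_all add: trivial_unitary_representation[OF cqg, simplified] tensor_unitary_representation[OF cqg _ U])

lemma tensor_power_dim: "dim_row (tensor_power U n) = dim_row U ^ n"
  by (induction n) (simp_all add: mult.commute)

primrec tensor_power_weights :: "nat \<Rightarrow> (nat \<Rightarrow> real) \<Rightarrow> nat \<Rightarrow> nat \<Rightarrow> real" where
  "tensor_power_weights m r 0 = (\<lambda>_. 1)"
| "tensor_power_weights m r (Suc n) = (\<lambda>t. tensor_power_weights m r n (t div m) * r (t mod m))"

lemma tensor_power_spherical_weights:
  fixes tens :: "'a::unital_cstar_algebra \<Rightarrow> 'a \<Rightarrow> 'b::unital_cstar_algebra"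
  assumes cqg: "compact_quantum_group tens tens_l tens_r \<Delta>" and U: "unitary_representation tens \<Delta> U"
    and r: "spherical_weights U r"
  shows "spherical_weights (tensor_power U n) (tensor_power_weights (dim_row U) r n)"
proof (induction n)
  case 0
  show ?case using spherical_weights_trivial[where 'a='a] by simp
next
  case (Suc n)
  note Un = unitary_representationD[OF tensor_power_unitary_representation[OF cqg U, of n]]
  note U' = unitary_representationD[OF U]
  show ?case
    using spherical_weights_tensor[OF Un(1,3,4) U'(1,3,4) Suc.IH r U'(2)] by simp
qed

text \<open>Traces of powers of an operator are multiplicative under tensor products.\<close>

lemma tensor_power_weights_sum:
  assumes "\<And>x y. f (x * y) = f x * f y" "f 1 = (1 :: real)"
  shows "(\<Sum>t<m ^ n. f (tensor_power_weights m r n t)) = (\<Sum>i<m. f (r i)) ^ n"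
proof (induction n)
  case (Suc n)
  have "(\<Sum>t<m ^ Suc n. f (tensor_power_weights m r (Suc n) t)) =
      (\<Sum>t<m ^ n * m. f (tensor_power_weights m r n (t div m)) * f (r (t mod m)))"
    by (simp add: assms mult.commute)
  also have "\<dots> = (\<Sum>i<m ^ n. \<Sum>k<m. f (tensor_power_weights m r n i) * f (r k))"
    by (rule sum_div_mod)
  also have "\<dots> = (\<Sum>i<m ^ n. f (tensor_power_weights m r n i)) * (\<Sum>k<m. f (r k))"
    by (simp add: sum_product)
  finally show ?case by (simp add: Suc.IH)
qed (simp add: assms)

text \<open>The class of the given subrepresentation of the \<open>n\<close>-th tensor power is one of the classes that \<open>growth\<close> counts, and the
  representative chosen there, being equivalent to it, has the same dimension.\<close>

lemma irreducible_dim_squared_le_growth: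
  fixes tens :: "'a::unital_cstar_algebra \<Rightarrow> 'a \<Rightarrow> 'b::unital_cstar_algebra"
  assumes cqg: "compact_quantum_group tens tens_l tens_r \<Delta>" and U: "unitary_representation tens \<Delta> U"
    and fin: "finite (irreducible_classes tens \<Delta> (diag_block_mat (map (tensor_power U) [0..<Suc n])))"
    and T: "T \<in> carrier_mat (dim_row U ^ n) d" "0 < d" "mat_adjoint T * T = 1\<^sub>m d"
      "T * mat_adjoint T \<in> End (tensor_power U n)"
    and irr: "irreducible_rep (compress T (tensor_power U n))"
  shows "d\<^sup>2 \<le> growth tens \<Delta> U n"
proof -
  let ?D = "diag_block_mat (map (tensor_power U) [0..<Suc n])"
  let ?S = "irreducible_subreps tens \<Delta> ?D"
  let ?R = "{(\<alpha>, \<beta>). \<alpha> \<in> ?S \<and> \<beta> \<in> ?S \<and> equivalent_rep \<alpha> \<beta>}"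
  note rep = tensor_power_unitary_representation[OF cqg U]
  note Un = unitary_representationD[OF rep[of n], unfolded tensor_power_dim]
  define \<alpha> where "\<alpha> = compress T (tensor_power U n)"
  have c\<alpha>: "\<alpha> \<in> carrier_mat d d" unfolding \<alpha>_def using T(1) Un(1) by (rule compress_closed)
  have \<alpha>: "unitary_representation tens \<Delta> \<alpha>"
    unfolding \<alpha>_def by (rule compress_unitary_representation[OF cqg rep tensor_power_dim T])
  have "amp T * \<alpha> = tensor_power U n * amp T"
    unfolding \<alpha>_def by (rule compress_intertwines(1)[OF T(1) Un(1) T(3,4)])
  then have "T \<in> Mor \<alpha> (tensor_power U n)" using T(1) c\<alpha> by (simp add: Mor_def tensor_power_dim)
  moreover have "square_mat A" if "A \<in> set (map (tensor_power U) [0..<Suc n])" for A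
    using that unitary_representationD(1)[OF rep] by (auto simp: square_mat.simps)
  ultimately obtain T' where T': "T' \<in> Mor \<alpha> ?D" "mat_adjoint T' * T' = 1\<^sub>m d"
    using isometric_intertwiner_into_diag_block[of "map (tensor_power U) [0..<Suc n]" "tensor_power U n" \<alpha> d T] c\<alpha> T(3)
    by auto
  have "inverts_mat (mat_adjoint T') T'"
    using T' c\<alpha> by (auto simp: inverts_mat_def Mor_def)
  then have \<alpha>S: "\<alpha> \<in> ?S"
    using T'(1) \<alpha> irr by (auto simp: irreducible_subreps_def \<alpha>_def)
  have \<alpha>R: "(\<alpha>, \<alpha>) \<in> ?R" using \<alpha>S equivalent_rep_refl[OF c\<alpha>] by simp
  define C where "C = ?R `` {\<alpha>}"
  have C: "C \<in> irreducible_classes tens \<Delta> ?D"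
    unfolding irreducible_classes_def C_def by (rule quotientI[OF \<alpha>S])
  have "(SOME \<beta>. \<beta> \<in> C) \<in> C" by (rule someI[of _ \<alpha>]) (use \<alpha>R in \<open>simp add: C_def\<close>)
  moreover have "equivalent_rep \<alpha> \<beta>" if "\<beta> \<in> C" for \<beta> using that by (auto simp: C_def)
  ultimately have "equivalent_rep \<alpha> (SOME \<beta>. \<beta> \<in> C)" by blast
  then have "dim_row (SOME \<beta>. \<beta> \<in> C) = d" using equivalent_rep_dim c\<alpha> by fastforce
  then have "d\<^sup>2 = (dim_row (SOME \<beta>. \<beta> \<in> C))\<^sup>2" by simp
  also have "\<dots> \<le> (\<Sum>C\<in>irreducible_classes tens \<Delta> ?D. (dim_row (SOME \<beta>. \<beta> \<in> C))\<^sup>2)"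
    by (rule member_le_sum[OF C _ fin]) simp
  finally show ?thesis by (simp add: growth_def)
qed

text \<open>A sum over an infinite set is zero, hence a nonzero value of \<open>growth\<close> certifies that there are only finitely many classes.\<close>

lemma power_sums_growth_bound:
  fixes tens :: "'a::unital_cstar_algebra \<Rightarrow> 'a \<Rightarrow> 'b::unital_cstar_algebra"
  assumes cqg: "compact_quantum_group tens tens_l tens_r \<Delta>" and U: "unitary_representation tens \<Delta> U"
    and r: "spherical_weights U r" and m: "m = dim_row U"
    and g: "growth tens \<Delta> U n \<noteq> 0"
  shows "(\<Sum>i<m. r i ^ k) ^ n \<le> real (growth tens \<Delta> U n) ^ (k + 1) * (\<Sum>i<m. 1 / r i ^ k) ^ n"
    "(\<Sum>i<m. 1 / r i ^ k) ^ n \<le> real (growth tens \<Delta> U n) ^ (k + 1) * (\<Sum>i<m. r i ^ k) ^ n"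
proof -
  have fin: "finite (irreducible_classes tens \<Delta> (diag_block_mat (map (tensor_power U) [0..<Suc n])))"
    using g unfolding growth_def by (meson sum.infinite)
  let ?W = "tensor_power U n" and ?w = "tensor_power_weights m r n"
  note rep = tensor_power_unitary_representation[OF cqg U, of n]
  note W = unitary_representationD[OF rep, unfolded tensor_power_dim, folded m]
  have bound: "real d ^ (k + 1) \<le> real (growth tens \<Delta> U n) ^ (k + 1)"
    if "T \<in> carrier_mat (m ^ n) d" "0 < d" "mat_adjoint T * T = 1\<^sub>m d"
      "T * mat_adjoint T \<in> End ?W" "irreducible_rep (compress T ?W)" for T d
  proof (rule power_mono)
    have "d \<le> d\<^sup>2" by (simp add: power2_eq_square)
    also have "\<dots> \<le> growth tens \<Delta> U n"
      by (rule irreducible_dim_squared_le_growth[OF cqg U fin that[unfolded m]])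
    finally show "real d \<le> real (growth tens \<Delta> U n)" by simp
  qed simp
  have one: "1\<^sub>m (m ^ n) * mat_adjoint (1\<^sub>m (m ^ n)) = (1\<^sub>m (m ^ n) :: complex mat)"
    "mat_adjoint (1\<^sub>m (m ^ n)) * 1\<^sub>m (m ^ n) = (1\<^sub>m (m ^ n) :: complex mat)" by simp_all
  have "(\<Sum>i<m ^ n. ?w i ^ k) \<le> real (growth tens \<Delta> U n) ^ (k + 1) * (\<Sum>i<m ^ n. 1 / ?w i ^ k) \<and>
    (\<Sum>i<m ^ n. 1 / ?w i ^ k) \<le> real (growth tens \<Delta> U n) ^ (k + 1) * (\<Sum>i<m ^ n. ?w i ^ k)"
    using weighted_trace_bound[OF cqg rep _ tensor_power_spherical_weights[OF cqg U r] bound,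
        where T = "1\<^sub>m (m ^ n)" and d = "m ^ n" and n = "m ^ n"]
      one_End[OF W(1)] W(2)
    by (simp add: one tensor_power_dim m)
  then show "(\<Sum>i<m. r i ^ k) ^ n \<le> real (growth tens \<Delta> U n) ^ (k + 1) * (\<Sum>i<m. 1 / r i ^ k) ^ n"
    "(\<Sum>i<m. 1 / r i ^ k) ^ n \<le> real (growth tens \<Delta> U n) ^ (k + 1) * (\<Sum>i<m. r i ^ k) ^ n"
    by (simp_all add: tensor_power_weights_sum[of "\<lambda>x. x ^ k"] tensor_power_weights_sum[of "\<lambda>x. 1 / x ^ k"] power_mult_distrib)
qed

text \<open>Take \<open>n\<close>-th roots.  The convergence to \<open>1\<close> also shows that \<open>g n\<close> is eventually nonzero.\<close>

lemma le_of_subexponential_factor: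
  fixes a b :: real and g :: "nat \<Rightarrow> nat"
  assumes a: "0 \<le> a" and b: "0 \<le> b"
    and g: "(\<lambda>n. root n (real (g n))) \<longlonglongrightarrow> 1"
    and le: "\<And>n. g n \<noteq> 0 \<Longrightarrow> a ^ n \<le> real (g n) ^ p * b ^ n"
  shows "a \<le> b"
proof -
  have "(\<lambda>n. root n (real (g n)) ^ p * b) \<longlonglongrightarrow> 1 ^ p * b"
    by (intro tendsto_intros g)
  then have lim: "(\<lambda>n. root n (real (g n)) ^ p * b) \<longlonglongrightarrow> b" by simp
  have "\<forall>\<^sub>F n in sequentially. root n (real (g n)) > 0"
    using g by (rule order_tendstoD(1)) simp
  then have "\<forall>\<^sub>F n in sequentially. a \<le> root n (real (g n)) ^ p * b"
    using eventually_gt_at_top[of 0]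
  proof eventually_elim
    case (elim n)
    then have "g n \<noteq> 0" by (auto intro: ccontr)
    from le[OF this] have "root n (a ^ n) \<le> root n (real (g n) ^ p * b ^ n)"
      using elim by simp
    then show ?case using elim a b
      by (simp add: real_root_mult real_root_power real_root_power_cancel)
  qed
  then show ?thesis using tendsto_lowerbound[OF lim] by simp
qed

theorem power_sums_symmetric:
  fixes tens :: "'a::unital_cstar_algebra \<Rightarrow> 'a \<Rightarrow> 'b::unital_cstar_algebra"
  assumes cqg: "compact_quantum_group tens tens_l tens_r \<Delta>" and growth: "dual_subexponential_growth tens \<Delta>"
    and U: "unitary_representation tens \<Delta> U"
    and r: "spherical_weights U r" and m: "m = dim_row U"
  shows "(\<Sum>i<m. r i ^ k) = (\<Sum>i<m. (1 / r i) ^ k)"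
proof -
  have g: "(\<lambda>n. root n (real (growth tens \<Delta> U n))) \<longlonglongrightarrow> 1"
    using growth U by (simp add: dual_subexponential_growth_def)
  have pos: "0 \<le> (\<Sum>i<m. r i ^ k)" "0 \<le> (\<Sum>i<m. 1 / r i ^ k)"
    using r by (auto simp: spherical_weights_def m less_imp_le intro!: sum_nonneg)
  note bound = power_sums_growth_bound[OF cqg U r m, where k = k]
  have "(\<Sum>i<m. r i ^ k) = (\<Sum>i<m. 1 / r i ^ k)"
    by (rule antisym[OF le_of_subexponential_factor[OF pos g bound(1)]
          le_of_subexponential_factor[OF pos(2,1) g bound(2)]])
  then show ?thesis by (simp add: power_divide)
qed

text \<open>Equality of power sums extends to all polynomials; a polynomial that vanishes at all values except \<open>v\<close> counts the multiplicity of \<open>v\<close>.\<close>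

lemma image_mset_eq_of_power_sums:
  fixes f g :: "nat \<Rightarrow> real"
  assumes "\<And>k. (\<Sum>i<m. f i ^ k) = (\<Sum>i<m. g i ^ k)"
  shows "image_mset f (mset_set {..<m}) = image_mset g (mset_set {..<m})"
proof (rule multiset_eqI)
  fix v
  have poly: "(\<Sum>i<m. poly p (f i)) = (\<Sum>i<m. poly p (g i))" for p
    unfolding poly_altdef by (subst (1 2) sum.swap) (simp add: assms flip: sum_distrib_left)
  define F where "F = (f ` {..<m} \<union> g ` {..<m}) - {v}"
  define p where "p = (\<Prod>w\<in>F. [:- w, 1:])"
  have fin: "finite F" by (simp add: F_def)
  have pv: "poly p v \<noteq> 0" using fin by (auto simp: p_def poly_prod F_def)
  have pF: "poly p w = 0" if "w \<in> F" for w using fin that by (auto simp: p_def poly_prod)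
  have count: "(\<Sum>i<m. poly p (h i)) = of_nat (count (image_mset h (mset_set {..<m})) v) * poly p v"
    if h: "h ` {..<m} \<subseteq> insert v F" for h
  proof -
    have "(\<Sum>i<m. poly p (h i)) = (\<Sum>i | i < m \<and> h i = v. poly p v)"
      by (rule sum.mono_neutral_cong_right) (use h pF in auto)
    also have "\<dots> = of_nat (card {i. i < m \<and> h i = v}) * poly p v" by simp
    also have "card {i. i < m \<and> h i = v} = count (image_mset h (mset_set {..<m})) v"
      by (auto simp: count_image_mset' intro!: arg_cong[where f=card])
    finally show ?thesis .
  qed
  have "f ` {..<m} \<subseteq> insert v F" "g ` {..<m} \<subseteq> insert v F" by (auto simp: F_def)
  then show "count (image_mset f (mset_set {..<m})) v = count (image_mset g (mset_set {..<m})) v"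
    using poly[of p] count pv by simp
qed

section \<open>Diagonalization of rho\<close>

lemma mat_inv_eqI:
  assumes "A \<in> carrier_mat n n" "B \<in> carrier_mat n n" "A * B = 1\<^sub>m n" "B * A = 1\<^sub>m n"
  shows "mat_inv A = B"
  unfolding mat_inv_def
proof (rule the_equality)
  show "inverts_mat A B \<and> inverts_mat B A" using assms by (simp add: inverts_mat_def)
next
  fix C assume C: "inverts_mat A C \<and> inverts_mat C A"
  then have AC: "A * C = 1\<^sub>m n" and CA: "C * A = 1\<^sub>m (dim_row C)" using assms(1) by (auto simp: inverts_mat_def)
  have dims: "dim_col C = n" "dim_row C = n"
    using arg_cong[OF AC, of dim_col] arg_cong[OF CA, of dim_col] assms(1) by auto
  have "C = (B * A) * C" unfolding assms(4) using dims by simp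
  also have "\<dots> = B * (A * C)" using assms(1,2) dims by (simp add: mat_assoc)
  finally show "C = B" using AC assms by simp
qed

text \<open>Polarization: the quadratic form is real on the vectors \<open>e\<^sub>i + c e\<^sub>j\<close> for \<open>c\<close> among \<open>0, 1, -1, \<i>, -\<i>\<close>.\<close>

lemma positive_hermitian:
  fixes A :: "complex mat"
  assumes A: "A \<in> carrier_mat n n" and pos: "\<And>v. v \<in> carrier_vec n \<Longrightarrow> 0 \<le> (A *\<^sub>v v) \<bullet>c v"
  shows "mat_adjoint A = A"
proof (rule eq_matI)
  fix i j assume "i < dim_row A" "j < dim_col A"
  then have i: "i < n" and j: "j < n" using A by auto
  have q: "Im (A $$ (i, i) + c * A $$ (i, j) + cnj c * A $$ (j, i) + cnj c * c * A $$ (j, j)) = 0" for c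
  proof -
    define v where "v = vec n (\<lambda>a. (if a = i then 1 else 0) + (if a = j then c else 0))"
    have v_index: "v $ a = (if a = i then 1 else 0) + (if a = j then c else 0)" if "a < n" for a
      using that by (simp add: v_def)
    have Av: "(A *\<^sub>v v) $ a = A $$ (a, i) + c * A $$ (a, j)" if a: "a < n" for a
    proof -
      have "(A *\<^sub>v v) $ a = (\<Sum>b<n. A $$ (a, b) * v $ b)"
        using a A by (simp add: scalar_prod_def v_def lessThan_atLeast0)
      also have "\<dots> = (\<Sum>b<n. (if b = i then A $$ (a, b) else 0) + (if b = j then c * A $$ (a, b) else 0))"
        by (intro sum.cong) (auto simp: v_def algebra_simps)
      finally show ?thesis using i j by (simp add: sum.distrib)
    qed
    have "(A *\<^sub>v v) \<bullet>c v = (\<Sum>a<n. (A *\<^sub>v v) $ a * cnj (v $ a))"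
      using A by (simp add: scalar_prod_def v_def lessThan_atLeast0)
    also have "\<dots> = (\<Sum>a<n. (if a = i then A $$ (a, i) + c * A $$ (a, j) else 0) +
        (if a = j then cnj c * (A $$ (a, i) + c * A $$ (a, j)) else 0))"
      by (intro sum.cong refl) (simp add: Av v_index algebra_simps del: index_mult_mat_vec)
    also have "\<dots> = A $$ (i, i) + c * A $$ (i, j) + cnj c * A $$ (j, i) + cnj c * c * A $$ (j, j)"
      using i j by (simp add: sum.distrib algebra_simps)
    finally show ?thesis using pos[of v] by (simp add: less_eq_complex_def v_def)
  qed
  have "Im (A $$ (i, i)) = 0" using q[of 0] by simp
  moreover have "Im (A $$ (i, i)) + Im (A $$ (i, j)) + Im (A $$ (j, i)) + Im (A $$ (j, j)) = 0"
    using q[of 1] by simp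
  moreover have "Im (A $$ (i, i)) - Im (A $$ (i, j)) - Im (A $$ (j, i)) + Im (A $$ (j, j)) = 0"
    using q[of "-1"] by simp
  moreover have "Im (A $$ (i, i)) + Re (A $$ (i, j)) - Re (A $$ (j, i)) + Im (A $$ (j, j)) = 0"
    using q[of \<i>] by simp
  moreover have "Im (A $$ (i, i)) - Re (A $$ (i, j)) + Re (A $$ (j, i)) + Im (A $$ (j, j)) = 0"
    using q[of "-\<i>"] by simp
  ultimately have "Re (A $$ (j, i)) = Re (A $$ (i, j))" "Im (A $$ (j, i)) = - Im (A $$ (i, j))" by linarith+
  then show "mat_adjoint A $$ (i, j) = A $$ (i, j)"
    using i j A by (simp add: complex_eq_iff)
qed (use A in auto)

theorem positive_invertible_diagonalization:
  assumes A: "A \<in> carrier_mat n n" "positive_invertible A"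
  obtains V r where "V \<in> carrier_mat n n" "mat_adjoint V * V = 1\<^sub>m n" "V * mat_adjoint V = 1\<^sub>m n"
    "mat_adjoint V * A * V = diag_of n (\<lambda>i. complex_of_real (r i))" "\<And>i. i < n \<Longrightarrow> 0 < r i"
proof -
  have pos: "0 \<le> (A *\<^sub>v v) \<bullet>c v" if "v \<in> carrier_vec n" for v
    using A that by (simp add: positive_invertible_def)
  obtain V r where V: "V \<in> carrier_mat n n" "mat_adjoint V * V = 1\<^sub>m n" "V * mat_adjoint V = 1\<^sub>m n"
    and D: "mat_adjoint V * A * V = diag_of n (\<lambda>i. complex_of_real (r i))"
    using hermitian_unitary_diagonalization[OF A(1) positive_hermitian[OF A(1) pos]] by blast
  obtain B where B: "A * B = 1\<^sub>m n" "B * A = 1\<^sub>m (dim_row B)"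
    using A by (auto simp: positive_invertible_def invertible_mat_def inverts_mat_def)
  have cB: "B \<in> carrier_mat n n"
    using arg_cong[OF B(1), of dim_col] arg_cong[OF B(2), of dim_col] A(1) by auto
  have aV: "mat_adjoint V \<in> carrier_mat n n" using V by simp
  have "0 < r i" if i: "i < n" for i
  proof -
    have "complex_of_real (r i) = (mat_adjoint V * (A * V)) $$ (i, i)"
      using arg_cong[OF D, of "\<lambda>M. M $$ (i, i)"] i V(1) A(1) by (simp add: diag_of_def mat_assoc)
    also have "\<dots> = (\<Sum>k<n. cnj (V $$ (k, i)) * (A * V) $$ (k, i))"
      using i V(1) A(1) by (subst mat_mult_index) auto
    also have "\<dots> = (A *\<^sub>v col V i) \<bullet>c col V i"
      using i V(1) A(1)
      by (auto simp: mat_mult_index scalar_prod_def lessThan_atLeast0 mult.commute intro!: sum.cong)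
    finally have eq: "complex_of_real (r i) = (A *\<^sub>v col V i) \<bullet>c col V i" .
    have "0 \<le> complex_of_real (r i)" unfolding eq by (rule pos) (use V(1) in \<open>simp add: carrier_vecI\<close>)
    then have "0 \<le> r i" by (simp add: less_eq_complex_def)
    moreover have "r i \<noteq> 0"
    proof -
      have "(mat_adjoint V * B * V) * (mat_adjoint V * A * V) = mat_adjoint V * B * ((V * mat_adjoint V) * (A * V))"
        using V(1) A(1) cB by (simp add: mat_assoc)
      also have "\<dots> = mat_adjoint V * ((B * A) * V)" using V A(1) cB by (simp add: mat_assoc)
      finally have "(mat_adjoint V * B * V) * diag_of n (\<lambda>i. complex_of_real (r i)) = 1\<^sub>m n"
        unfolding D using V cB B by simp
      moreover have "mat_adjoint V * B * V \<in> carrier_mat n n"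
        using aV cB V(1) by (intro mult_carrier_mat)
      ultimately show ?thesis
        using i mult_diag_of_index[of "mat_adjoint V * B * V" n n i i "\<lambda>i. complex_of_real (r i)"] by auto
    qed
    ultimately show ?thesis by simp
  qed
  with V D that show thesis by blast
qed

lemma mat_trace_mult_commute:
  fixes A B :: "complex mat"
  assumes "A \<in> carrier_mat n m" "B \<in> carrier_mat m n"
  shows "mat_trace (A * B) = mat_trace (B * A)"
  unfolding mat_trace_def using assms
  by (simp add: mat_mult_index) (subst sum.swap, simp add: mult.commute)

lemma eigenvalue_list_unitary_diag:
  assumes V: "V \<in> carrier_mat n n" "mat_adjoint V * V = 1\<^sub>m n" "V * mat_adjoint V = 1\<^sub>m n"
  shows "eigenvalue_list (V * diag_of n (\<lambda>i. complex_of_real (r i)) * mat_adjoint V) =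
    rev (sorted_list_of_multiset (image_mset r (mset_set {..<n})))"
proof -
  let ?D = "diag_of n (\<lambda>i. complex_of_real (r i))"
  have aV: "mat_adjoint V \<in> carrier_mat n n" using V by simp
  have "similar_mat (V * ?D * mat_adjoint V) ?D"
    unfolding similar_mat_def similar_mat_wit_def
    by (intro exI[of _ V] exI[of _ "mat_adjoint V"]) (use V aV in \<open>auto simp: Let_def\<close>)
  then have "char_poly (V * ?D * mat_adjoint V) = char_poly ?D" by (rule char_poly_similar)
  also have "\<dots> = (\<Prod>a\<leftarrow>diag_mat ?D. [:- a, 1:])"
    by (rule char_poly_upper_triangular[of _ n]) (auto simp: diag_of_def)
  also have "diag_mat ?D = map (\<lambda>i. complex_of_real (r i)) [0..<n]"
    by (simp add: diag_mat_def diag_of_def)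
  finally have "proots (char_poly (V * ?D * mat_adjoint V)) = proots (\<Prod>i<n. [:- complex_of_real (r i), 1:])"
    by (simp add: o_def prod.list_conv_set_nth interv_sum_list_conv_sum_set_nat lessThan_atLeast0 flip: prod.distinct_set_conv_list)
  also have "\<dots> = (\<Sum>i<n. {#complex_of_real (r i)#})"
    by (subst proots_prod) auto
  also have "\<dots> = image_mset (\<lambda>i. complex_of_real (r i)) (mset_set {..<n})"
    by (simp add: sum_unfold_sum_mset)
  finally show ?thesis
    by (simp add: eigenvalue_list_def multiset.map_comp o_def)
qed

lemma star_mat_compress:
  assumes "dim_row W = dim_row T" "dim_col W = dim_row T"
  shows "star_mat (compress T W) = compress T (star_mat W)"
  using assms by (simp add: compress_def star_mat_mult star_mat_amp mat_assoc)

text \<open>Over a noncommutative ring transposition need not reverse products; it does when one of the factors is scalar.\<close>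

lemma transpose_mult_amp:
  "dim_col A = dim_row S \<Longrightarrow> transpose_mat (A * amp S) = amp (transpose_mat S) * transpose_mat A"
  "dim_col S = dim_row A \<Longrightarrow> transpose_mat (amp S * A) = transpose_mat A * amp (transpose_mat S)"
  by (rule eq_matI; simp add: mat_mult_index mult_scaleC_left mult_scaleC_right)+

text \<open>Transposition turns a change of basis by \<open>T\<close> into one by the complex conjugate of \<open>T\<close>.\<close>

lemma transpose_compress:
  assumes "dim_row W = dim_row T" "dim_col W = dim_row T"
  shows "transpose_mat (compress T W) = compress (transpose_mat (mat_adjoint T)) (transpose_mat W)"
proof -
  have "mat_adjoint (transpose_mat (mat_adjoint T)) = transpose_mat T"
    by (rule eq_matI) auto
  then show ?thesis
    using assms by (simp add: compress_def transpose_mult_amp mat_assoc)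
qed

text \<open>For unitary \<open>U\<close> the contragredient \<open>U1\<close> is the entrywise adjoint of \<open>U\<close>, and the transpose of \<open>U2\<close> is its inverse.  In an eigenbasis of \<open>\<rho>\<close>
  the intertwining relation expresses \<open>U2\<close> through \<open>U\<close> and the weights, which turns the two inverse relations into the two orthogonality
  relations.  The trace condition is invariant under the change of basis.\<close>

theorem rho_spherical_weights:
  fixes U :: "'a::unital_cstar_algebra mat"
  assumes U: "unitary_representation tens \<Delta> U" and n: "dim_row U = n"
    and rho: "is_rho tens \<Delta> U \<rho>"
  obtains V r where "V \<in> carrier_mat n n" "mat_adjoint V * V = 1\<^sub>m n" "V * mat_adjoint V = 1\<^sub>m n"
    "\<rho> = V * diag_of n (\<lambda>i. complex_of_real (r i)) * mat_adjoint V"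
    "mat_inv \<rho> = V * diag_of n (\<lambda>i. complex_of_real (1 / r i)) * mat_adjoint V"
    "spherical_weights (compress V U) r"
proof -
  note U' = unitary_representationD[OF U, unfolded n]
  obtain U1 U2 where c1: "is_contragredient tens \<Delta> U U1" and c2: "is_contragredient tens \<Delta> U1 U2"
    and mor: "\<rho> \<in> Mor U U2" and pos: "positive_invertible \<rho>"
    and tr: "\<And>T. T \<in> End U \<Longrightarrow> mat_trace (T * \<rho>) = mat_trace (T * mat_inv \<rho>)"
    using rho by (auto simp: is_rho_def)
  have contra: "B \<in> carrier_mat n n \<and> A * transpose_mat B = 1\<^sub>m n \<and> transpose_mat B * A = 1\<^sub>m n"
    if "is_contragredient tens \<Delta> A B" "A \<in> carrier_mat n n" for A B :: "'a mat"
  proof -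
    have AB: "A * transpose_mat B = 1\<^sub>m n" "transpose_mat B * A = 1\<^sub>m (dim_col B)"
      using that by (auto simp: is_contragredient_def inverts_mat_def)
    have "dim_row B = n" "dim_col B = n"
      using arg_cong[OF AB(1), of dim_col] arg_cong[OF AB(2), of dim_col] that(2) by auto
    with AB show ?thesis by auto
  qed
  note C1 = contra[OF c1 U'(1)]
  then have U1: "U1 \<in> carrier_mat n n" by simp
  note C2 = contra[OF c2 U1]
  then have U2: "U2 \<in> carrier_mat n n" by simp
  have "transpose_mat U1 = star_mat U * U * transpose_mat U1" using U' U1 by simp
  also have "\<dots> = star_mat U * (U * transpose_mat U1)" using U'(1) U1 by (simp add: mat_assoc)
  finally have "transpose_mat U1 = star_mat U" using C1 U' by simp
  then have U1_eq: "U1 = transpose_mat (star_mat U)" by (metis transpose_transpose)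
  have \<rho>: "\<rho> \<in> carrier_mat n n" and \<rho>U: "amp \<rho> * U = U2 * amp \<rho>"
    using mor U2 n by (auto simp: Mor_def)
  obtain V r where V: "V \<in> carrier_mat n n" "mat_adjoint V * V = 1\<^sub>m n" "V * mat_adjoint V = 1\<^sub>m n"
    and D: "mat_adjoint V * \<rho> * V = diag_of n (\<lambda>i. complex_of_real (r i))" and r: "\<And>i. i < n \<Longrightarrow> 0 < r i"
    using positive_invertible_diagonalization[OF \<rho> pos] by blast
  let ?D = "diag_of n (\<lambda>i. complex_of_real (r i))" and ?E = "diag_of n (\<lambda>i. complex_of_real (1 / r i))"
  let ?a = "mat_adjoint V"
  have aV: "?a \<in> carrier_mat n n" using V by simp
  have "\<rho> = (V * ?a) * \<rho> * (V * ?a)" using V \<rho> by simp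
  also have "\<dots> = V * (?a * \<rho> * V) * ?a" using V(1) \<rho> by (simp add: mat_assoc)
  finally have \<rho>_eq: "\<rho> = V * ?D * ?a" unfolding D .
  have diag_index: "diag_of n f $$ (i, j) = (if i = j then f i else 0)" if "i < n" "j < n" for f i j
    using that by (simp add: diag_of_def)
  have diag_inverse: "diag_of n f * diag_of n g = 1\<^sub>m n" if "\<And>i. i < n \<Longrightarrow> f i * g i = 1" for f g
    by (rule eq_matI) (auto simp: mult_diag_of_index[of _ n n] that diag_index)
  have DE: "?D * ?E = 1\<^sub>m n" "?E * ?D = 1\<^sub>m n"
    by (rule diag_inverse; use r in force)+
  have inv: "mat_inv \<rho> = V * ?E * ?a"
  proof (rule mat_inv_eqI[OF \<rho>])
    show "V * ?E * ?a \<in> carrier_mat n n" using V aV by (auto intro!: mult_carrier_mat)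
    have "\<rho> * (V * ?E * ?a) = V * (?D * ((?a * V) * (?E * ?a)))"
      unfolding \<rho>_eq using V(1) by (simp add: mat_assoc)
    also have "\<dots> = V * ((?D * ?E) * ?a)" unfolding V(2) using V(1) by (simp add: mat_assoc)
    finally show "\<rho> * (V * ?E * ?a) = 1\<^sub>m n" unfolding DE using V by simp
    have "V * ?E * ?a * \<rho> = V * (?E * ((?a * V) * (?D * ?a)))"
      unfolding \<rho>_eq using V(1) by (simp add: mat_assoc)
    also have "\<dots> = V * ((?E * ?D) * ?a)" unfolding V(2) using V(1) by (simp add: mat_assoc)
    finally show "V * ?E * ?a * \<rho> = 1\<^sub>m n" unfolding DE using V by simp
  qed
  define u where "u = compress V U"
  define w where "w = compress V U2"
  have cu: "u \<in> carrier_mat n n" and cw: "w \<in> carrier_mat n n"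
    unfolding u_def w_def using V U'(1) U2 by (auto intro!: compress_closed)
  have uw: "complex_of_real (r k) *\<^sub>C u $$ (k, j) = complex_of_real (r j) *\<^sub>C w $$ (k, j)"
    if kj: "k < n" "j < n" for k j
  proof -
    have "amp ?D * u = compress V (amp \<rho> * U)"
      unfolding D[symmetric] u_def using V \<rho> U'(1) by (simp add: compress_mult compress_amp)
    also have "\<dots> = w * amp ?D"
      unfolding \<rho>U D[symmetric] w_def using V \<rho> U2 by (simp add: compress_mult compress_amp)
    finally have *: "(amp ?D * u) $$ (k, j) = (w * amp ?D) $$ (k, j)" by simp
    have "(amp ?D * u) $$ (k, j) = (\<Sum>l<n. ?D $$ (k, l) *\<^sub>C u $$ (l, j))"
      using kj cu by (simp add: mat_mult_index mult_scaleC_left)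
    also have "\<dots> = (\<Sum>l<n. if l = k then complex_of_real (r k) *\<^sub>C u $$ (l, j) else 0)"
      using kj by (intro sum.cong) (auto simp: diag_index)
    finally have l: "(amp ?D * u) $$ (k, j) = complex_of_real (r k) *\<^sub>C u $$ (k, j)" using kj by simp
    have "(w * amp ?D) $$ (k, j) = (\<Sum>l<n. ?D $$ (l, j) *\<^sub>C w $$ (k, l))"
      using kj cw by (simp add: mat_mult_index mult_scaleC_right)
    also have "\<dots> = (\<Sum>l<n. if l = j then complex_of_real (r j) *\<^sub>C w $$ (k, l) else 0)"
      using kj by (intro sum.cong) (auto simp: diag_index)
    finally have "(w * amp ?D) $$ (k, j) = complex_of_real (r j) *\<^sub>C w $$ (k, j)" using kj by simp
    with l show ?thesis using * by simp
  qed
  \<comment> \<open>The complex conjugate of \<open>V\<close>.\<close>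
  define Q where "Q = transpose_mat ?a"
  have aQ: "mat_adjoint Q = transpose_mat V" unfolding Q_def by (rule eq_matI) auto
  have Q: "Q \<in> carrier_mat n n" "Q * mat_adjoint Q = 1\<^sub>m n" "mat_adjoint Q * Q = 1\<^sub>m n"
  proof -
    show "Q \<in> carrier_mat n n" using aV by (simp add: Q_def)
    show "Q * mat_adjoint Q = 1\<^sub>m n"
      unfolding aQ unfolding Q_def using transpose_mult[OF V(1) aV] V(3) by simp
    show "mat_adjoint Q * Q = 1\<^sub>m n"
      unfolding aQ unfolding Q_def using transpose_mult[OF aV V(1)] V(2) by simp
  qed
  have cone: "compress Q (1\<^sub>m n) = (1\<^sub>m n :: 'a mat)"
    using compress_amp[of Q "1\<^sub>m n", where 'a='a] Q by simp
  have tu: "transpose_mat (star_mat u) = compress Q U1"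
    unfolding u_def U1_eq Q_def using V(1) U'(1) by (simp add: star_mat_compress transpose_compress)
  have tw: "transpose_mat w = compress Q (transpose_mat U2)"
    unfolding w_def Q_def using V(1) U2 by (simp add: transpose_compress)
  have inv1: "transpose_mat (star_mat u) * transpose_mat w = 1\<^sub>m n"
    unfolding tu tw using C2 U1 U2 Q by (simp add: cone flip: compress_mult[OF Q(1,2)])
  have inv2: "transpose_mat w * transpose_mat (star_mat u) = 1\<^sub>m n"
    unfolding tu tw using C2 U1 U2 Q by (simp add: cone flip: compress_mult[OF Q(1,2)])
  have inv1': "(\<Sum>i<n. star (u $$ (j, i)) * w $$ (k, i)) = (if j = k then 1 else 0)" if "j < n" "k < n" for j k
  proof -
    have "(transpose_mat (star_mat u) * transpose_mat w) $$ (j, k) = (\<Sum>i<n. star (u $$ (j, i)) * w $$ (k, i))"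
      using that cu cw by (simp add: mat_mult_index)
    then show ?thesis unfolding inv1 using that by simp
  qed
  have inv2': "(\<Sum>i<n. w $$ (i, j) * star (u $$ (i, k))) = (if j = k then 1 else 0)" if "j < n" "k < n" for j k
  proof -
    have "(transpose_mat w * transpose_mat (star_mat u)) $$ (j, k) = (\<Sum>i<n. w $$ (i, j) * star (u $$ (i, k)))"
      using that cu cw by (simp add: mat_mult_index)
    then show ?thesis unfolding inv2 using that by simp
  qed
  have A: "(\<Sum>i<n. (complex_of_real (r i) *\<^sub>C u $$ (i, j)) * star (u $$ (i, k))) =
      (if j = k then complex_of_real (r j) else 0) *\<^sub>C 1" if "j < n" "k < n" for j k
  proof -
    have "(\<Sum>i<n. (complex_of_real (r i) *\<^sub>C u $$ (i, j)) * star (u $$ (i, k))) =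
      complex_of_real (r j) *\<^sub>C (\<Sum>i<n. w $$ (i, j) * star (u $$ (i, k)))"
      using that by (simp add: uw cspace.scale_sum_right mult_scaleC_left)
    then show ?thesis using that by (simp add: inv2')
  qed
  have B: "(\<Sum>i<n. (complex_of_real (1 / r i) *\<^sub>C star (u $$ (j, i))) * u $$ (k, i)) =
      (if j = k then complex_of_real (1 / r j) else 0) *\<^sub>C 1" if jk: "j < n" "k < n" for j k
  proof -
    have wk: "complex_of_real (1 / r i) *\<^sub>C u $$ (k, i) = complex_of_real (1 / r k) *\<^sub>C w $$ (k, i)" if "i < n" for i
      using arg_cong[OF uw[OF jk(2) that], of "\<lambda>x. complex_of_real (1 / (r i * r k)) *\<^sub>C x"] r[OF that] r[OF jk(2)]
      by (simp add: scaleC_scaleC)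
    have "(\<Sum>i<n. (complex_of_real (1 / r i) *\<^sub>C star (u $$ (j, i))) * u $$ (k, i)) =
        (\<Sum>i<n. star (u $$ (j, i)) * (complex_of_real (1 / r i) *\<^sub>C u $$ (k, i)))"
      by (simp only: mult_scaleC_left mult_scaleC_right)
    also have "\<dots> = complex_of_real (1 / r k) *\<^sub>C (\<Sum>i<n. star (u $$ (j, i)) * w $$ (k, i))"
      unfolding cspace.scale_sum_right by (intro sum.cong refl) (simp only: wk lessThan_iff mult_scaleC_right)
    finally show ?thesis using jk by (simp add: inv1')
  qed
  have T: "(\<Sum>i<n. X $$ (i, i) * complex_of_real (r i)) = (\<Sum>i<n. X $$ (i, i) * complex_of_real (1 / r i))"
    if X: "X \<in> End u" for X
  proof -
    have cX: "X \<in> carrier_mat n n" using EndD(1)[OF X cu] .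
    have Y: "V * X * ?a \<in> End U"
      using End_of_compress[OF V(1) U'(1) V(2)] one_End[OF U'(1)] V(3) X by (simp add: u_def)
    have trace: "mat_trace (V * X * ?a * (V * diag_of n d * ?a)) = (\<Sum>i<n. X $$ (i, i) * d i)" for d
    proof -
      have "V * X * ?a * (V * diag_of n d * ?a) = V * ((X * ((?a * V) * diag_of n d)) * ?a)"
        using V(1) cX by (simp add: mat_assoc)
      also have "\<dots> = V * ((X * diag_of n d) * ?a)" unfolding V(2) by simp
      finally have "mat_trace (V * X * ?a * (V * diag_of n d * ?a)) = mat_trace (V * ((X * diag_of n d) * ?a))" by simp
      also have "\<dots> = mat_trace (((X * diag_of n d) * ?a) * V)"
        by (rule mat_trace_mult_commute[of _ n n]) (use V(1) aV cX in auto)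
      also have "((X * diag_of n d) * ?a) * V = X * diag_of n d * (?a * V)"
        using V(1) cX by (simp add: mat_assoc)
      also have "\<dots> = X * diag_of n d" unfolding V(2) using cX by simp
      also have "mat_trace (X * diag_of n d) = (\<Sum>i<n. X $$ (i, i) * d i)"
        using cX by (simp add: mat_trace_def mult_diag_of_index[OF cX])
      finally show ?thesis .
    qed
    show ?thesis using tr[OF Y] unfolding inv unfolding \<rho>_eq trace .
  qed
  have "spherical_weights (compress V U) r"
    unfolding spherical_weights_def using r A B T cu by (simp flip: u_def)
  with V \<rho>_eq inv that show thesis by blast
qed

theorem corollary3p6:
  fixes tens :: "'a::unital_cstar_algebra \<Rightarrow> 'a \<Rightarrow> 'b::unital_cstar_algebra"
    and tens_l :: "'b \<Rightarrow> 'a \<Rightarrow> 'c::unital_cstar_algebra"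
    and tens_r :: "'a \<Rightarrow> 'b \<Rightarrow> 'c"
    and \<Delta> :: "'a \<Rightarrow> 'b"
    and U :: "'a mat" and \<rho> :: "complex mat"
  assumes "compact_quantum_group tens tens_l tens_r \<Delta>"
    and "dual_subexponential_growth tens \<Delta>"
    and "unitary_representation tens \<Delta> U"
    and "is_rho tens \<Delta> U \<rho>"
  shows "eigenvalue_list \<rho> = eigenvalue_list (mat_inv \<rho>)"
proof -
  define n where "n = dim_row U"
  note U = unitary_representationD[OF assms(3), folded n_def]
  obtain V r where V: "V \<in> carrier_mat n n" "mat_adjoint V * V = 1\<^sub>m n" "V * mat_adjoint V = 1\<^sub>m n"
    and \<rho>: "\<rho> = V * diag_of n (\<lambda>i. complex_of_real (r i)) * mat_adjoint V"
      "mat_inv \<rho> = V * diag_of n (\<lambda>i. complex_of_real (1 / r i)) * mat_adjoint V"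
    and r: "spherical_weights (compress V U) r"
    by (rule rho_spherical_weights[OF assms(3) n_def[symmetric] assms(4)])
  have "unitary_representation tens \<Delta> (compress V U)"
    using one_End[OF U(1)]
    by (intro compress_unitary_representation[OF assms(1,3) n_def[symmetric] V(1) U(2) V(2)]) (simp add: V(3))
  moreover have "n = dim_row (compress V U)" using compress_closed[OF V(1) U(1)] by simp
  ultimately have "(\<Sum>i<n. r i ^ k) = (\<Sum>i<n. (1 / r i) ^ k)" for k
    by (intro power_sums_symmetric[OF assms(1,2) _ r])
  then have "image_mset r (mset_set {..<n}) = image_mset (\<lambda>i. 1 / r i) (mset_set {..<n})"
    by (rule image_mset_eq_of_power_sums)
  then show ?thesis
    unfolding \<rho>(2) unfolding \<rho>(1) eigenvalue_list_unitary_diag[OF V] by simp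
qed

end
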